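(* Let $\beta>0$. Every nonzero zero of $\phi_\beta$ lies in the open left half-plane. There are only finitely many nonreal zeros, counted with multiplicity, and they occur in conjugate pairs. If $\beta=n_\beta$ is a positive integer, then $1/\phi_{n_\beta}$ is rational, $\mathcal Z_{n_\beta}$ consists of exactly $n_\beta$ simple zeros, and: if $n_\beta$ is even, all these zeros are nonreal; if $n_\beta$ is odd, $-3n_\beta-4$ is the unique real zero among them. If $\beta$ is noninteger, let $\beta=n_\beta+\theta_\beta$ with $n_\beta=\lfloor\beta\rfloor$ and $\theta_\beta\in(0,1)$. If $n_\beta$ is even, then $\phi_\beta$ has exactly $n_\beta$ nonreal zeros, counted with multiplicity. If $n_\beta$ is odd, then $\phi_\beta$ has at most $n_\beta+1$ nonreal zeros, counted with multiplicity; if this upper bound is attained, then all real zeros are simple. Moreover, for every $\sigma>0$ such that $\phi_\beta$ has no zero on the line $\operatorname{Re}z=-\sigma$, the set $$\mathcal Z_{\beta,\sigma}:=\{\rho\in\mathcal Z_\beta:-\sigma<\operatorname{Re}\rho<0\}$$ is finite.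
   Context: For $\beta>0$, $\phi_\beta$ denotes the meromorphic function on $\mathbb C$ $$\phi_\beta(z)=B(\beta+2,\beta+1)-B(z+\beta+2,\beta+1),\qquad B(a,b)=\frac{\Gamma(a)\Gamma(b)}{\Gamma(a+b)},$$ which for $\operatorname{Re}z\ge0$ equals $\int_0^1(1-s^z)s^{\beta+1}(1-s)^\beta\,ds$. The set of distinct nonzero zeros of $\phi_\beta$ is denoted $\mathcal Z_\beta$. *)

theory Defs
  imports "HOL-Complex_Analysis.Complex_Analysis"
begin

(* Gamma is 0 at its poles and x / 0 = 0, so for integer \<beta> the raw expression has the wrong
   value at the removable singularities z = -2\<beta>-3, -2\<beta>-4, ..., where Gamma (z+\<beta>+2) and
   Gamma (z+2\<beta>+3) both have poles. remove_sings fills in the limit there; at the poles of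
   the resulting meromorphic function it gives the value 0. *)
definition phi :: "real \<Rightarrow> complex \<Rightarrow> complex" where
  "phi \<beta> = remove_sings (\<lambda>z.
     Beta (of_real \<beta> + 2) (of_real \<beta> + 1) - Beta (z + of_real \<beta> + 2) (of_real \<beta> + 1))"

(* The value of phi at a pole is 0 by convention, so poles have to be excluded. *)
definition zeros :: "real \<Rightarrow> complex set" where
  "zeros \<beta> = {z. \<not> is_pole (phi \<beta>) z \<and> phi \<beta> z = 0}"

definition nonzero_zeros :: "real \<Rightarrow> complex set" where
  "nonzero_zeros \<beta> = zeros \<beta> - {0}"

definition nonreal_zeros :: "real \<Rightarrow> complex set" where
  "nonreal_zeros \<beta> = {z \<in> zeros \<beta>. z \<notin> \<real>}"

definition simple_zero :: "real \<Rightarrow> complex \<Rightarrow> bool" where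
  "simple_zero \<beta> z \<longleftrightarrow> z \<in> zeros \<beta> \<and> zorder (phi \<beta>) z = 1"

(* Only meaningful once nonreal_zeros is known to be finite. *)
definition num_nonreal_zeros :: "real \<Rightarrow> int" where
  "num_nonreal_zeros \<beta> = (\<Sum>z\<in>nonreal_zeros \<beta>. zorder (phi \<beta>) z)"

(* Equality as meromorphic functions; values on the finite zero set of q are irrelevant. *)
definition rational_function :: "(complex \<Rightarrow> complex) \<Rightarrow> bool" where
  "rational_function f \<longleftrightarrow>
     (\<exists>p q. q \<noteq> 0 \<and> (\<forall>z. poly q z \<noteq> 0 \<longrightarrow> f z = poly p z / poly q z))"

end

theory Submission
  imports Defs "HOL-Computational_Algebra.Fundamental_Theorem_Algebra"
begin

text \<open>
  Put \<open>b = \<beta> + 1\<close>, \<open>w = z + \<beta> + 2\<close> and \<open>r(w) = \<Gamma>(w) / \<Gamma>(w + b)\<close>. Then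
  \<open>\<phi>\<^sub>\<beta>(z) = \<Gamma>(b) (r(b + 1) - r(w))\<close>, so the zeros of \<open>\<phi>\<^sub>\<beta>\<close> are the solutions of
  \<open>r(w) = c\<close> with \<open>c = r(b + 1) > 0\<close>, and the zero \<open>z = 0\<close> is the solution \<open>w = b + 1\<close>. Comparing the
  factors of Euler's product for \<open>\<Gamma>\<close> gives \<open>\<bar>r(w)\<bar> \<le> r(Re w)\<close> in the right half-plane, strictly off
  the axis, and \<open>r\<close> decreases on the positive axis. Hence no other solution has \<open>Re w \<ge> b + 1\<close>.

  Let \<open>\<beta> = n + \<theta>\<close> with \<open>0 < \<theta> < 1\<close>. Then \<open>r\<close> has a simple pole at every \<open>-k\<close>, and by the functional
  equation and the reflection formula it is small far from these poles: \<open>\<bar>r\<bar> < c\<close> if \<open>\<bar>Im w\<bar>\<close> is large,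
  and on \<open>Re w = -K - 1/2\<close> if \<open>K\<close> is large. On a large rectangle with this left edge,
  Rouche's theorem compares \<open>r - c\<close> with \<open>-c\<close>, so there are as many solutions as poles
  (\<open>sum_ratio_order\<close>): \<open>K + 1\<close> with multiplicity. Many of them are real. The sign of
  the residue at \<open>-k\<close> alternates for \<open>k \<le> n + 1\<close> and is constant from \<open>n + 1\<close> on. Between two poles whose
  residues have the same sign, \<open>r\<close> runs from one infinity to the other, so each gap \<open>(-k - 1, -k)\<close> with
  \<open>n + 1 \<le> k < K\<close> contains a solution (\<open>solution_between_poles\<close>). Together with \<open>b + 1\<close> these
  are \<open>K - n\<close> real solutions, and at most \<open>n + 1\<close> are left, counted with multiplicity. If \<open>n + 1\<close> of them are
  nonreal, then every real solution is among the \<open>K - n\<close> found and is simple.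

  For even \<open>n\<close> the residues from \<open>n + 1\<close> on are negative, so \<open>r\<close> tends to \<open>\<infinity>\<close> at the left of \<open>-K\<close> and there is
  one further real solution in \<open>(-K - 1/2, -K)\<close>. That there are no more, and that all are simple, follows
  from two facts. By the reflection formula, \<open>r(-k - t)\<close> is for \<open>0 < t < 1\<close> and \<open>k > n\<close> the product of
  \<open>r(k + 1 - b + t)\<close> and \<open>sin \<pi>(\<theta> - t) / sin \<pi>t\<close>; both factors are positive and decreasing for \<open>t < \<theta>\<close>, and the product
  is not positive for \<open>t \<ge> \<theta>\<close>. Between \<open>-n - 1\<close> and \<open>0\<close> one has \<open>\<bar>r\<bar> > c\<close>
  (\<open>no_negative_solution_right_of\<close>). So exactly \<open>n\<close> solutions are nonreal.

  If \<open>\<beta> = n\<close> is an integer, then \<open>1 / r\<close> is the polynomial \<open>w (w + 1) \<cdots> (w + n)\<close>, and the zeros of \<open>\<phi>\<^sub>n\<close>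
  are the \<open>n + 1\<close> points where it takes the value \<open>(n + 2) \<cdots> (2n + 2)\<close>. Its critical points lie in \<open>[-n, 0]\<close>,
  where its modulus is smaller than this value, so the zeros are simple. On the real axis it is monotone outside
  \<open>[-n, 0]\<close> and symmetric under \<open>w \<mapsto> -n - w\<close> up to the sign \<open>(-1)^(n + 1)\<close>; the mirror image
  \<open>w = -2n - 2\<close> of \<open>w = n + 2\<close> is a solution just for odd \<open>n\<close>, and corresponds to \<open>z = -3n - 4\<close>.
\<close>

section \<open>The ratio of Gamma functions\<close>

text \<open>
  Since \<open>rGamma\<close> is entire, this form of the ratio is singular at most at the poles of \<open>\<Gamma>(w)\<close>. There the
  value is 0 by convention, so these points are excluded wherever the ratio is set equal to a constant.
\<close>
definition gamma_ratio :: "'a :: Gamma \<Rightarrow> 'a \<Rightarrow> 'a" where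
  "gamma_ratio b w = Gamma w * rGamma (w + b)"

lemma gamma_ratio_of_real:
  "gamma_ratio (of_real b) (of_real x) = (of_real (gamma_ratio b x) :: complex)"
  by (simp add: gamma_ratio_def Gamma_complex_of_real flip: rGamma_complex_of_real)

lemma cnj_gamma_ratio: "cnj (gamma_ratio (of_real b) w) = gamma_ratio (of_real b) (cnj w)"
  by (simp add: gamma_ratio_def cnj_Gamma cnj_rGamma)

lemma gamma_ratio_pos: "x > 0 \<Longrightarrow> b \<ge> 0 \<Longrightarrow> gamma_ratio b x > (0::real)"
  by (simp add: gamma_ratio_def rGamma_inverse_Gamma)

lemma gamma_ratio_shift:
  assumes "w \<notin> \<int>\<^sub>\<le>\<^sub>0"
  shows   "gamma_ratio b w = (w + b) / w * gamma_ratio b (w + 1)"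
proof -
  have "w \<noteq> 0" using assms by auto
  then show ?thesis
    using Gamma_plus1[OF assms] rGamma_plus1[of "w + b"]
    by (simp add: gamma_ratio_def field_simps add_ac)
qed

lemma gamma_ratio_diff1:
  assumes "w + b \<noteq> 1"
  shows   "gamma_ratio b w = gamma_ratio (b - 1) w / (w + b - 1)"
  using rGamma_plus1[of "w + b - 1"] assms
  by (simp add: gamma_ratio_def field_simps)

lemma not_nonpos_Int_if_Re_pos: "Re w > 0 \<Longrightarrow> w \<notin> \<int>\<^sub>\<le>\<^sub>0"
  by (auto elim!: nonpos_Ints_cases)

text \<open>
  In Euler's limit formula the ratio is a limit of products of \<open>(w + i + b) / (w + i) = 1 + b / (w + i)\<close>
  times a factor that does not depend on \<open>w\<close>. Since \<open>\<bar>w + i\<bar> \<ge> Re w + i\<close>, replacing \<open>w\<close> by its real part can only increase the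
  modulus of every factor.
\<close>
lemma norm_gamma_ratio_le:
  assumes "Re w > 0" "b \<ge> 0"
  shows   "norm (gamma_ratio (of_real b) w) \<le> gamma_ratio b (Re w)"
proof -
  define x where "x = Re w"
  have x: "x > 0" using assms by (simp add: x_def)
  define F :: "complex \<Rightarrow> nat \<Rightarrow> complex" where "F = (\<lambda>w n. Gamma_series w n * rGamma_series (w + of_real b) n)"
  have lim: "F w \<longlonglongrightarrow> gamma_ratio (of_real b) w" for w
    unfolding gamma_ratio_def F_def by (intro tendsto_intros)
  have F: "F w n = exp (- of_real (b * ln (real n))) * (\<Prod>i=0..<n+1. (w + of_nat i + of_real b) / (w + of_nat i))" for w n
    unfolding F_def Gamma_series_def rGamma_series_def pochhammer_prod
    by (simp add: prod_dividef exp_add exp_minus field_simps ring_distribs del: prod.op_ivl_Suc)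
  have le: "norm (F w n) \<le> norm (F (of_real x) n)" for n
  proof -
    have "norm ((w + of_nat i + of_real b) / (w + of_nat i)) \<le> norm ((of_real x + of_nat i + of_real b) / (of_real x + of_nat i :: complex))" for i
    proof -
      have r: "norm (w + of_nat i) \<ge> x + i"
        using complex_Re_le_cmod[of "w + of_nat i"] by (simp add: x_def)
      have "norm ((w + of_nat i + of_real b) / (w + of_nat i)) \<le> (norm (w + of_nat i) + b) / norm (w + of_nat i)"
        unfolding norm_divide using assms(2)
        by (intro divide_right_mono) (auto intro: order.trans[OF norm_triangle_ineq])
      also have "\<dots> = 1 + b / norm (w + of_nat i)"
        using r x by (cases "norm (w + of_nat i) = 0") (auto simp: add_divide_distrib)
      also have "\<dots> \<le> 1 + b / (x + i)"
        using r x assms(2) by (intro add_left_mono divide_left_mono) (auto intro!: mult_pos_pos)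
      also have "\<dots> = (x + i + b) / (x + i)"
        using x by (simp add: field_simps)
      also have "\<dots> = norm (of_real ((x + i + b) / (x + i)) :: complex)"
        unfolding norm_of_real using x assms(2) by simp
      finally show ?thesis by simp
    qed
    then show ?thesis
      unfolding F norm_mult prod_norm[symmetric]
      by (intro mult_left_mono prod_mono) auto
  qed
  have "norm (gamma_ratio (of_real b) w) \<le> norm (gamma_ratio (of_real b) (of_real x :: complex))"
    by (rule tendsto_le[OF sequentially_bot tendsto_norm[OF lim] tendsto_norm[OF lim]])
       (use le in auto)
  also have "\<dots> = gamma_ratio b x"
    using gamma_ratio_pos[OF x assms(2)] by (simp add: gamma_ratio_of_real)
  finally show ?thesis by (simp add: x_def)
qed

text \<open>
  A limit loses strictness, so one factor is split off by the functional equation; this factor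
  already increases strictly when \<open>w\<close> moves to the real axis.
\<close>
lemma norm_gamma_ratio_less:
  assumes "Re w > 0" "b > 0" "Im w \<noteq> 0"
  shows   "norm (gamma_ratio (of_real b) w) < gamma_ratio b (Re w)"
proof -
  define x where "x = Re w"
  have x: "x > 0" using assms by (simp add: x_def)
  have less: "norm ((w + of_real b) / w) < (x + b) / x"
  proof -
    have "(norm (w + of_real b) * x)\<^sup>2 < ((x + b) * norm w)\<^sup>2"
    proof -
      have "((x + b) * norm w)\<^sup>2 - (norm (w + of_real b) * x)\<^sup>2 = (Im w)\<^sup>2 * (b\<^sup>2 + 2 * b * x)"
        unfolding power_mult_distrib cmod_power2 by (simp add: x_def power2_eq_square algebra_simps)
      moreover have "\<dots> > 0"
        using assms x by (intro mult_pos_pos add_pos_pos) auto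
      ultimately show ?thesis by linarith
    qed
    then have "norm (w + of_real b) * x < (x + b) * norm w"
      using x assms by (intro power2_less_imp_less[where y = "(x + b) * norm w"]) auto
    moreover have "norm w > 0" using assms by auto
    ultimately show ?thesis using x by (simp add: norm_divide field_simps)
  qed
  \<comment> \<open>The strict inequality for the first factor survives the weak one for the others.\<close>
  have "norm (gamma_ratio (of_real b) w) = norm ((w + of_real b) / w) * norm (gamma_ratio (of_real b) (w + 1))"
    using gamma_ratio_shift[OF not_nonpos_Int_if_Re_pos[OF assms(1)], of "of_real b"]
    by (simp only: norm_mult)
  also have "\<dots> \<le> norm ((w + of_real b) / w) * gamma_ratio b (x + 1)"
    using norm_gamma_ratio_le[of "w + 1" b] assms by (intro mult_left_mono) (auto simp: x_def)
  also have "\<dots> < (x + b) / x * gamma_ratio b (x + 1)"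
    using less gamma_ratio_pos[of "x + 1" b] x assms by (intro mult_strict_right_mono) auto
  also have "\<dots> = gamma_ratio b x"
    by (rule gamma_ratio_shift[symmetric]) (use x in \<open>auto elim!: nonpos_Ints_cases\<close>)
  finally show ?thesis by (simp add: x_def)
qed

text \<open>
  The logarithmic derivative is \<open>\<psi>(x) - \<psi>(x + b)\<close>, and \<open>\<psi>\<close> increases.
\<close>
lemma gamma_ratio_deriv_neg:
  assumes "x > 0" "b > (0::real)"
  obtains D where "(gamma_ratio b has_real_derivative D) (at x)" "D < 0"
proof
  show "(gamma_ratio b has_real_derivative gamma_ratio b x * (Digamma x - Digamma (x + b))) (at x)"
    unfolding gamma_ratio_def[abs_def]
    by (rule derivative_eq_intros refl | use assms in \<open>force elim!: nonpos_Ints_cases simp: algebra_simps\<close>)+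
  show "gamma_ratio b x * (Digamma x - Digamma (x + b)) < 0"
    using gamma_ratio_pos[of x b] Digamma_real_strict_mono[of x "x + b"] assms
    by (intro mult_pos_neg) auto
qed

lemma gamma_ratio_strict_antimono:
  assumes "0 < x" "x < y" "b > (0::real)"
  shows   "gamma_ratio b y < gamma_ratio b x"
proof (rule DERIV_neg_imp_decreasing[OF assms(2)])
  fix t assume "x \<le> t" "t \<le> y"
  with assms show "\<exists>d. (gamma_ratio b has_real_derivative d) (at t) \<and> d < 0"
    using gamma_ratio_deriv_neg[of t b] by (metis less_le_trans)
qed

text \<open>
  Lowering \<open>b\<close> by one produces the factor \<open>1 / (w + b - 1)\<close>, which supplies the decay. The remaining ratio
  is bounded on \<open>Re w \<ge> 1\<close> by its value at 1.
\<close>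
lemma norm_gamma_ratio_le_inverse:
  assumes "Re w \<ge> 1" "b > 1"
  shows   "norm (gamma_ratio (of_real b) w) \<le> 1 / (Gamma b * norm (w + of_real b - 1))"
proof -
  have ne: "w + of_real b \<noteq> 1"
    using assms by (auto simp: complex_eq_iff)
  have "norm (gamma_ratio (of_real (b - 1)) w) \<le> gamma_ratio (b - 1) (Re w)"
    using assms by (intro norm_gamma_ratio_le) auto
  also have "\<dots> \<le> gamma_ratio (b - 1) 1"
    using gamma_ratio_strict_antimono[of 1 "Re w" "b - 1"] assms by (cases "Re w = 1") auto
  also have "\<dots> = 1 / Gamma b"
    by (simp add: gamma_ratio_def rGamma_inverse_Gamma divide_inverse)
  finally have "norm (gamma_ratio (of_real b - 1) w) \<le> 1 / Gamma b" by simp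
  then have "norm (gamma_ratio (of_real b - 1) w) / norm (w + of_real b - 1) \<le> 1 / Gamma b / norm (w + of_real b - 1)"
    by (rule divide_right_mono) simp
  then show ?thesis
    by (simp add: gamma_ratio_diff1[OF ne] norm_divide)
qed

text \<open>
  The reflection formula at \<open>w\<close> and at \<open>w + b\<close>. It relates the left half-plane, where all the poles are,
  to the right half-plane, where the ratio is under control.
\<close>
lemma gamma_ratio_reflect:
  fixes w b :: complex
  assumes "1 - b - w \<notin> \<int>\<^sub>\<le>\<^sub>0" "w \<notin> \<int>\<^sub>\<le>\<^sub>0"
  shows   "gamma_ratio b w * sin (of_real pi * w) = gamma_ratio b (1 - b - w) * sin (of_real pi * (w + b))"
proof -
  have 1: "sin (of_real pi * (w + b)) = of_real pi * (rGamma (w + b) * rGamma (1 - b - w))"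
    using rGamma_reflection_complex[of "w + b"] by (simp add: algebra_simps)
  have 2: "sin (of_real pi * w) = of_real pi * (rGamma w * rGamma (1 - w))"
    using rGamma_reflection_complex[of w] by simp
  have "rGamma w \<noteq> 0" "rGamma (1 - b - w) \<noteq> 0"
    using assms by (auto simp: rGamma_eq_zero_iff)
  then show ?thesis
    unfolding 1 2 by (simp add: gamma_ratio_def Gamma_def)
qed

text \<open>
  This bounds the quotient of sines in the reflection formula on the two kinds of lines that stay away from the
  poles: horizontal ones, and vertical ones halfway between integers. It follows from
  \<open>2 \<bar>sin(x + iy)\<bar>\<^sup>2 = cosh 2y - cos 2x\<close>, where a real shift changes only \<open>cos 2x\<close>.
\<close>
lemma norm_sin_plus_real_le:
  fixes w :: complex
  assumes "\<bar>Im w\<bar> \<ge> 1 \<or> cos (pi * Re w) = 0"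
  shows   "norm (sin (of_real pi * (w + of_real b))) \<le> 2 * norm (sin (of_real pi * w))"
proof -
  define S where "S = cosh (2 * pi * Im w)"
  have sq: "(norm (sin (of_real pi * u)))\<^sup>2 = (cosh (2 * pi * Im u) - cos (2 * (pi * Re u))) / 2" for u
    by (simp add: norm_sin_squared cosh_def exp_minus mult.assoc)
  have S: "3 * S \<ge> 5 \<or> cos (2 * (pi * Re w)) = -1" "S \<ge> 1"
  proof -
    show "3 * S \<ge> 5 \<or> cos (2 * (pi * Re w)) = -1"
    proof (cases "cos (pi * Re w) = 0")
      case False
      then have "\<bar>Im w\<bar> \<ge> 1" using assms by auto
      then have "2 * pi * \<bar>Im w\<bar> \<ge> 2 * 3 * 1" using pi_gt3 by (intro mult_mono) auto
      moreover define y where "y = 2 * pi * \<bar>Im w\<bar>"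
      ultimately have "exp y \<ge> 7"
        using exp_ge_add_one_self[of y] by linarith
      moreover have "2 * S = exp y + exp (- y)"
        by (auto simp: S_def cosh_def abs_if y_def)
      moreover have "exp (- y) > 0" by simp
      ultimately have "2 * S \<ge> 7 + 0" by (metis add_mono less_imp_le)
      then have "3 * S \<ge> 5" by simp
      then show ?thesis ..
    qed (simp add: cos_double_cos)
    show "S \<ge> 1" unfolding S_def by (rule cosh_real_ge_1)
  qed
  have "(norm (sin (of_real pi * (w + of_real b))))\<^sup>2 \<le> (S + 1) / 2"
    unfolding sq using cos_ge_minus_one[of "2 * (pi * (Re w + b))"]
    by (simp add: S_def del: cos_ge_minus_one)
  also have "(S + 1) / 2 \<le> 4 * ((S - cos (2 * (pi * Re w))) / 2)"
  proof -
    have "1 + S \<le> 4 * (S - C)" if "3 * S \<ge> 5 \<or> C = -1" "C \<le> 1" for C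
      using that S(2) by auto
    from this[OF S(1) cos_le_one] show ?thesis by simp
  qed
  also have "\<dots> = (2 * norm (sin (of_real pi * w)))\<^sup>2"
    unfolding power_mult_distrib sq by (simp add: S_def)
  finally show ?thesis by (rule power2_le_imp_le) simp
qed

section \<open>Decay away from the poles\<close>

lemma norm_gamma_ratio_left:
  assumes "Re w \<le> -b" "\<bar>Im w\<bar> \<ge> 1 \<or> cos (pi * Re w) = 0" "b > 1"
  shows   "norm (gamma_ratio (of_real b) w) \<le> 2 / (Gamma b * norm w)"
proof -
  have "w \<notin> \<int>"
  proof
    assume "w \<in> \<int>"
    then obtain k where k: "w = of_int k" by (auto elim: Ints_cases)
    then have "\<bar>cos (pi * Re w)\<bar> = 1"
      by simp
    with k assms(2) show False by auto
  qed
  then have nz: "norm (sin (of_real pi * w)) > 0" and w: "w \<notin> \<int>\<^sub>\<le>\<^sub>0"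
    by (auto simp: sin_eq_0 dest: nonpos_Ints_Int)
  have "norm (gamma_ratio (of_real b) w) * norm (sin (of_real pi * w))
      = norm (gamma_ratio (of_real b) (1 - of_real b - w)) * norm (sin (of_real pi * (w + of_real b)))"
    using assms
    by (subst norm_mult[symmetric], subst gamma_ratio_reflect) (auto simp: norm_mult w intro!: not_nonpos_Int_if_Re_pos)
  also have "\<dots> \<le> 1 / (Gamma b * norm w) * (2 * norm (sin (of_real pi * w)))"
  proof (rule mult_mono)
    show "norm (gamma_ratio (of_real b) (1 - of_real b - w)) \<le> 1 / (Gamma b * norm w)"
      using norm_gamma_ratio_le_inverse[of "1 - of_real b - w" b] assms by simp
  qed (use assms norm_sin_plus_real_le in auto)
  finally have "norm (gamma_ratio (of_real b) w) * norm (sin (of_real pi * w))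
      \<le> 2 / (Gamma b * norm w) * norm (sin (of_real pi * w))" by simp
  then show ?thesis using nz by (simp only: mult_le_cancel_right_pos)
qed

text \<open>
  Each step of the functional equation costs a factor \<open>1 + b / w\<close>, whose modulus is at most \<open>1 + b\<close> as \<open>\<bar>w\<bar> \<ge> 1\<close>.
  Finitely many steps carry the strip to the left of \<open>Re w = 1\<close> into the half-plane where the decay is known.
\<close>
lemma norm_gamma_ratio_shift_le:
  assumes "\<bar>Im w\<bar> \<ge> 1" "b \<ge> 0"
  shows   "norm (gamma_ratio (of_real b) w) \<le> (1 + b) ^ m * norm (gamma_ratio (of_real b) (w + of_nat m))"
proof (induction m)
  case (Suc m)
  define u where "u = w + of_nat m"
  have u: "\<bar>Im u\<bar> \<ge> 1" using assms by (simp add: u_def)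
  then have n1: "norm u \<ge> 1" using abs_Im_le_cmod[of u] by linarith
  have "u \<notin> \<int>\<^sub>\<le>\<^sub>0" using u by (auto elim!: nonpos_Ints_cases)
  then have "norm (gamma_ratio (of_real b) u) = norm ((u + of_real b) / u) * norm (gamma_ratio (of_real b) (u + 1))"
    by (metis gamma_ratio_shift norm_mult)
  also have "norm ((u + of_real b) / u) \<le> 1 + b"
  proof -
    have "norm (u + of_real b) \<le> norm u + b"
      using norm_triangle_ineq[of u "of_real b"] assms by simp
    also have "\<dots> \<le> (1 + b) * norm u"
      using n1 assms(2) mult_left_mono[of 1 "norm u" b] by (simp add: algebra_simps)
    finally show ?thesis using n1 using assms(2) by (auto simp: norm_divide divide_le_eq)
  qed
  finally have "norm (gamma_ratio (of_real b) u) \<le> (1 + b) * norm (gamma_ratio (of_real b) (u + 1))"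
    by (simp add: mult_right_mono)
  then have "(1 + b) ^ m * norm (gamma_ratio (of_real b) u) \<le> (1 + b) ^ m * ((1 + b) * norm (gamma_ratio (of_real b) (u + 1)))"
    using assms by (intro mult_left_mono) auto
  with Suc.IH show ?case by (simp add: u_def add_ac mult_ac)
qed simp

text \<open>
  Points with \<open>Re w \<le> -b\<close> are reflected, all others are shifted to the right by a fixed integer.
\<close>
lemma norm_gamma_ratio_le_Im:
  assumes "b > 1"
  obtains M where "M > 0" "\<And>w. \<bar>Im w\<bar> \<ge> 1 \<Longrightarrow> norm (gamma_ratio (of_real b) w) \<le> M / \<bar>Im w\<bar>"
proof
  \<comment> \<open>This many steps carry \<open>Re w > -b\<close> to real parts at least 1.\<close>
  define m where "m = nat \<lceil>b\<rceil> + 1"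
  define M where "M = (2 + (1 + b) ^ m) / Gamma b"
  have G: "Gamma b > 0" using assms by simp
  show "M > 0" using assms G by (simp add: M_def add_pos_pos)
  fix w :: complex assume w: "\<bar>Im w\<bar> \<ge> 1"
  show "norm (gamma_ratio (of_real b) w) \<le> M / \<bar>Im w\<bar>"
  proof (cases "Re w \<le> -b")
    case True
    then have "norm (gamma_ratio (of_real b) w) \<le> 2 / (Gamma b * norm w)"
      using assms w by (intro norm_gamma_ratio_left) auto
    also have "\<dots> \<le> 2 / (Gamma b * \<bar>Im w\<bar>)"
      using w G abs_Im_le_cmod[of w] by (intro divide_left_mono mult_left_mono mult_pos_pos) auto
    also have "\<dots> \<le> M / \<bar>Im w\<bar>"
      using w G assms by (simp add: M_def field_simps)
    finally show ?thesis .
  next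
    case False
    then have Re: "Re (w + of_nat m) \<ge> 1"
      unfolding m_def using assms by simp linarith
    have "norm (gamma_ratio (of_real b) w) \<le> (1 + b) ^ m * norm (gamma_ratio (of_real b) (w + of_nat m))"
      using assms w by (intro norm_gamma_ratio_shift_le) auto
    also have "\<dots> \<le> (1 + b) ^ m * (1 / (Gamma b * norm (w + of_nat m + of_real b - 1)))"
      using norm_gamma_ratio_le_inverse[OF Re assms] assms by (intro mult_left_mono) auto
    also have "\<dots> \<le> (1 + b) ^ m * (1 / (Gamma b * \<bar>Im w\<bar>))"
      using w G abs_Im_le_cmod[of "w + of_nat m + of_real b - 1"] assms
      by (intro divide_left_mono mult_left_mono mult_pos_pos) auto
    also have "\<dots> \<le> M / \<bar>Im w\<bar>"
      using w G assms by (simp add: M_def field_simps)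
    finally show ?thesis .
  qed
qed

lemma norm_gamma_ratio_less_if_Im_large:
  assumes "b > 1" "c > 0"
  obtains T where "T \<ge> 1" "\<And>w. \<bar>Im w\<bar> \<ge> T \<Longrightarrow> norm (gamma_ratio (of_real b) w) < c"
proof -
  obtain M where M: "M > 0" "\<And>w. \<bar>Im w\<bar> \<ge> 1 \<Longrightarrow> norm (gamma_ratio (of_real b) w) \<le> M / \<bar>Im w\<bar>"
    using norm_gamma_ratio_le_Im[OF assms(1)] by blast
  show ?thesis
  proof (rule that[of "1 + M / c"])
    show "1 + M / c \<ge> 1" using M assms by simp
    fix w :: complex assume w: "\<bar>Im w\<bar> \<ge> 1 + M / c"
    moreover have "M / c > 0" using M assms by simp
    ultimately have 1: "\<bar>Im w\<bar> \<ge> 1" and "\<bar>Im w\<bar> > M / c" by linarith+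
    then have "M / \<bar>Im w\<bar> < c" using assms M by (simp add: field_simps)
    with M(2)[OF 1] show "norm (gamma_ratio (of_real b) w) < c" by linarith
  qed
qed

lemma norm_gamma_ratio_less_if_Re_half_integer:
  assumes "b > 1" "c > 0"
  obtains K0 :: nat where
    "\<And>K w. K \<ge> K0 \<Longrightarrow> Re w = - real K - 1/2 \<Longrightarrow> norm (gamma_ratio (of_real b) w) < c"
proof -
  define R where "R = max b (2 / (Gamma b * c))"
  have G: "Gamma b > 0" using assms by simp
  show ?thesis
  proof (rule that[of "nat \<lceil>R\<rceil>"])
    fix K w assume K: "nat \<lceil>R\<rceil> \<le> K" and w: "Re w = - real K - 1/2"
    have RK: "R \<le> K" using K by linarith
    have "cos (pi * Re w) = 0"
      unfolding w using cos_zero_iff_int[of "pi * (- real K - 1/2)"]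
      by (auto simp: algebra_simps intro!: exI[of _ "- 2 * int K - 1"])
    then have "norm (gamma_ratio (of_real b) w) \<le> 2 / (Gamma b * norm w)"
      using assms w RK by (intro norm_gamma_ratio_left) (auto simp: R_def)
    also have nw: "norm w > 2 / (Gamma b * c)" "norm w > 0"
      using abs_Re_le_cmod[of w] w RK by (auto simp: R_def)
    have "2 / (Gamma b * norm w) < c"
      using G assms nw by (simp add: divide_less_eq mult_ac)
    finally show "norm (gamma_ratio (of_real b) w) < c" .
  qed
qed

lemma norm_gamma_ratio_less_if_Re_large:
  assumes "b > 0" "x > 0" "Re w \<ge> x" "w \<noteq> of_real x"
  shows   "norm (gamma_ratio (of_real b) w) < gamma_ratio b x"
proof (cases "Re w = x")
  case True
  then have "Im w \<noteq> 0" using assms by (auto simp: complex_eq_iff)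
  then show ?thesis using norm_gamma_ratio_less[of w b] True assms by simp
next
  case False
  then have "gamma_ratio b (Re w) < gamma_ratio b x"
    using assms by (intro gamma_ratio_strict_antimono) auto
  moreover have "norm (gamma_ratio (of_real b) w) \<le> gamma_ratio b (Re w)"
    using assms by (intro norm_gamma_ratio_le) auto
  ultimately show ?thesis by linarith
qed

text \<open>
  This is \<open>\<Gamma>(q + 1) / \<Gamma>(q + 1 + p) \<le> \<Gamma>(1) / \<Gamma>(1 + p)\<close>, an instance of the monotonicity of the ratio.
\<close>
lemma Gamma_mult_Gamma_le:
  assumes "p \<ge> 0" "q \<ge> (0::real)"
  shows   "Gamma (p + 1) * Gamma (q + 1) \<le> Gamma (p + q + 1)"
proof (cases "p = 0 \<or> q = 0")
  case False
  then have "gamma_ratio p (q + 1) < gamma_ratio p 1"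
    using assms by (intro gamma_ratio_strict_antimono) auto
  then show ?thesis
    using assms by (simp add: gamma_ratio_def rGamma_inverse_Gamma field_simps add_ac)
qed auto

section \<open>Counting solutions with a rectangle\<close>

text \<open>
  Rouche's theorem for a rectangular path counts zeros with winding numbers, which are 1 inside and 0 outside. The
  strict inequality rules out zeros on the path itself.
\<close>
lemma Rouche_rectangle:
  assumes "open S" "connected S" "f holomorphic_on S" "g holomorphic_on S"
    and "finite {z\<in>S. f z + g z = 0}" "finite {z\<in>S. f z = 0}"
    and less: "Re a < Re b" "Im a < Im b" and sub: "cbox a b \<subseteq> S"
    and bd: "\<And>z. z \<in> cbox a b - box a b \<Longrightarrow> norm (g z) < norm (f z)"
  shows "(\<Sum>z | z \<in> box a b \<and> f z + g z = 0. zorder (\<lambda>z. f z + g z) z)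
       = (\<Sum>z | z \<in> box a b \<and> f z = 0. zorder f z)"
proof -
  let ?\<gamma> = "rectpath a b"
  have img: "path_image ?\<gamma> = cbox a b - box a b"
    using less by (intro path_image_rectpath_cbox_minus_box) auto
  have wind: "(\<Sum>z\<in>{z\<in>S. h z = 0}. winding_number ?\<gamma> z * of_int (zorder h z))
      = of_int (\<Sum>z | z \<in> box a b \<and> h z = 0. zorder h z)"
    if fin: "finite {z\<in>S. h z = 0}" and nz: "\<And>z. z \<in> cbox a b - box a b \<Longrightarrow> h z \<noteq> 0" for h
  proof -
    have "(\<Sum>z\<in>{z\<in>S. h z = 0}. winding_number ?\<gamma> z * of_int (zorder h z))
        = (\<Sum>z | z \<in> box a b \<and> h z = 0. winding_number ?\<gamma> z * of_int (zorder h z))"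
    proof (rule sum.mono_neutral_right[OF fin])
      show "{z. z \<in> box a b \<and> h z = 0} \<subseteq> {z \<in> S. h z = 0}"
        using sub box_subset_cbox[of a b] by auto
      show "\<forall>z\<in>{z \<in> S. h z = 0} - {z. z \<in> box a b \<and> h z = 0}. winding_number ?\<gamma> z * of_int (zorder h z) = 0"
      proof
        fix z assume "z \<in> {z \<in> S. h z = 0} - {z. z \<in> box a b \<and> h z = 0}"
        then have "z \<notin> cbox a b" using nz by auto
        then show "winding_number ?\<gamma> z * of_int (zorder h z) = 0"
          using less by (simp add: winding_number_rectpath_outside)
      qed
    qed
    also have "\<dots> = (\<Sum>z | z \<in> box a b \<and> h z = 0. of_int (zorder h z))"
      by (intro sum.cong) (auto simp: winding_number_rectpath)
    finally show ?thesis by simp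
  qed
  have ne: "f z \<noteq> 0 \<and> f z + g z \<noteq> 0" if z: "z \<in> cbox a b - box a b" for z
  proof -
    have "norm (g z) < norm (f z)" using bd z by blast
    moreover from this have "norm (f z + g z) > 0"
      using norm_diff_ineq[of "f z" "g z"] by linarith
    ultimately show ?thesis by auto
  qed
  have "(\<Sum>z\<in>{z\<in>S. f z + g z = 0}. winding_number ?\<gamma> z * of_int (zorder (\<lambda>z. f z + g z) z))
      = (\<Sum>z\<in>{z\<in>S. f z = 0}. winding_number ?\<gamma> z * of_int (zorder f z))"
  proof (rule Rouche_theorem[OF assms(1,2,5,6,3,4)])
    show "\<forall>z. z \<notin> S \<longrightarrow> winding_number ?\<gamma> z = 0"
      using sub less by (auto intro!: winding_number_rectpath_outside)
  qed (use sub bd in \<open>auto simp: img\<close>)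
  then have "of_int (\<Sum>z | z \<in> box a b \<and> f z + g z = 0. zorder (\<lambda>z. f z + g z) z)
      = (of_int (\<Sum>z | z \<in> box a b \<and> f z = 0. zorder f z) :: complex)"
    using wind[OF assms(5)] wind[OF assms(6)] ne by simp
  then show ?thesis by (simp only: of_int_eq_iff)
qed

text \<open>
  This is the ratio multiplied by \<open>w (w + 1) \<cdots> (w + K)\<close>. It cancels the poles at \<open>0, -1, \<dots>, -K\<close>, and writing
  the product in this form makes it visibly holomorphic on \<open>Re w > -K - 1\<close>, without removable singularities.
\<close>
definition cleared_ratio :: "'a :: Gamma \<Rightarrow> nat \<Rightarrow> 'a \<Rightarrow> 'a" where
  "cleared_ratio b K w = Gamma (w + of_nat (Suc K)) * rGamma (w + b)"

lemma cleared_ratio_eq: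
  assumes "w \<notin> \<int>\<^sub>\<le>\<^sub>0"
  shows   "cleared_ratio b K w = pochhammer w (Suc K) * gamma_ratio b w"
  using pochhammer_Gamma[OF assms, of "Suc K"] assms
  by (simp add: cleared_ratio_def gamma_ratio_def Gamma_eq_zero_iff field_simps)

lemma holomorphic_cleared_ratio:
  "cleared_ratio (b :: complex) K holomorphic_on {w. Re w > - real K - 1}"
  unfolding cleared_ratio_def[abs_def]
  by (intro holomorphic_intros not_nonpos_Int_if_Re_pos) auto

lemma pochhammer_zeros:
  "pochhammer w (Suc K) = 0 \<longleftrightarrow> w \<in> (\<lambda>k. - of_nat k) ` {..K}" for w :: complex
  by (auto simp: pochhammer_eq_0_iff less_Suc_eq_le)

lemma zorder_pochhammer:
  assumes "k \<le> K" "C \<noteq> 0"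
  shows   "zorder (\<lambda>w::complex. C * pochhammer w (Suc K)) (- of_nat k) = 1"
proof (rule simple_zeroI[where S = UNIV])
  let ?g = "\<lambda>w::complex. C * (\<Prod>i\<in>{0..<Suc K} - {k}. w + of_nat i)"
  show "?g holomorphic_on UNIV" by (intro holomorphic_intros)
  show "?g (- of_nat k) \<noteq> 0" using assms(2) by (auto simp: add_eq_0_iff)
  show "C * pochhammer w (Suc K) = ?g w * (w - - of_nat k)" for w
    unfolding pochhammer_prod using assms(1) by (subst prod.remove[of _ k]) auto
qed auto

text \<open>
  For noninteger \<open>b\<close> no zero of \<open>rGamma (w + b)\<close> falls on a pole of \<open>\<Gamma>(w)\<close>, so all these poles are genuine and
  clearing them creates no new zeros.
\<close>
lemma cleared_ratio_nonzero_at_pole: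
  fixes b :: "'a :: Gamma"
  assumes "b \<notin> \<int>" "k \<le> K"
  shows   "cleared_ratio b K (- of_nat k) \<noteq> 0"
proof -
  have "- of_nat k + of_nat (Suc K) = (of_nat (Suc K - k) :: 'a)"
    using assms by (subst of_nat_diff) auto
  moreover have "of_nat (Suc K - k) \<notin> (\<int>\<^sub>\<le>\<^sub>0 :: 'a set)"
    using assms by (subst of_nat_in_nonpos_Ints_iff) auto
  ultimately have "- of_nat k + of_nat (Suc K) \<notin> (\<int>\<^sub>\<le>\<^sub>0 :: 'a set)"
    by metis
  moreover have "- of_nat k + b \<notin> \<int>\<^sub>\<le>\<^sub>0"
    using assms(1) Ints_add[of "- of_nat k + b" "of_nat k"] by (auto dest!: nonpos_Ints_Int)
  ultimately show ?thesis by (simp add: cleared_ratio_def Gamma_eq_zero_iff rGamma_eq_zero_iff)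
qed

lemma cleared_ratio_eq_iff:
  fixes w :: complex
  assumes "b \<notin> \<int>" "Re w > - real K - 1"
  shows "cleared_ratio b K w = c * pochhammer w (Suc K) \<longleftrightarrow> w \<notin> \<int>\<^sub>\<le>\<^sub>0 \<and> gamma_ratio b w = c"
proof (cases "w \<in> \<int>\<^sub>\<le>\<^sub>0")
  case True
  then obtain k where k: "w = - of_nat k" by (auto elim!: nonpos_Ints_cases')
  with assms have "k \<le> K" by auto
  then show ?thesis
    using cleared_ratio_nonzero_at_pole[OF assms(1), of k K] True k pochhammer_zeros[of w K] by auto
next
  case False
  then have "pochhammer w (Suc K) \<noteq> 0"
    by (auto dest: pochhammer_eq_0_imp_nonpos_Int)
  then show ?thesis using False by (simp add: cleared_ratio_eq)
qed

definition ratio_solutions :: "real \<Rightarrow> complex set" where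
  "ratio_solutions b = {w. w \<notin> \<int>\<^sub>\<le>\<^sub>0 \<and> gamma_ratio (of_real b) w = of_real (gamma_ratio b (b + 1))}"

definition ratio_order :: "real \<Rightarrow> complex \<Rightarrow> int" where
  "ratio_order b w = zorder (\<lambda>u. gamma_ratio (of_real b) u - of_real (gamma_ratio b (b + 1))) w"

lemma ratio_solutions_Re_le:
  assumes "w \<in> ratio_solutions b" "b > 0"
  shows   "Re w \<le> b + 1" "Re w = b + 1 \<Longrightarrow> w = of_real (b + 1)"
proof -
  have "gamma_ratio b (b + 1) > 0" using assms by (intro gamma_ratio_pos) auto
  then have *: "\<not> (Re w \<ge> b + 1 \<and> w \<noteq> of_real (b + 1))"
    using assms norm_gamma_ratio_less_if_Re_large[of b "b + 1" w] by (auto simp: ratio_solutions_def)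
  then show "Re w = b + 1 \<Longrightarrow> w = of_real (b + 1)" by auto
  from * show "Re w \<le> b + 1" by (cases "w = of_real (b + 1)") auto
qed

lemma analytic_gamma_ratio: "w \<notin> \<int>\<^sub>\<le>\<^sub>0 \<Longrightarrow> gamma_ratio (b :: complex) analytic_on {w}"
  unfolding gamma_ratio_def[abs_def] by (intro analytic_intros) auto

text \<open>
  The ratio is holomorphic on the plane without the nonpositive integers, which is connected, and it is not constantly
  \<open>c\<close> there because its value at \<open>b + 2\<close> is smaller. So its solutions are isolated and have positive finite order.
\<close>
lemma eventually_not_ratio_solution:
  fixes w :: complex
  assumes "w \<notin> \<int>\<^sub>\<le>\<^sub>0" "b > 0"
  shows   "eventually (\<lambda>u. u \<notin> \<int>\<^sub>\<le>\<^sub>0 \<and> gamma_ratio (of_real b) u - of_real (gamma_ratio b (b + 1)) \<noteq> 0) (at w)"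
proof -
  let ?f = "\<lambda>u::complex. gamma_ratio (of_real b) u - of_real (gamma_ratio b (b + 1))"
  let ?S = "UNIV - \<int>\<^sub>\<le>\<^sub>0 :: complex set"
  have "of_real (b + 2) \<in> ?S" using assms(2) by (auto intro!: not_nonpos_Int_if_Re_pos)
  moreover from this have "?f (of_real (b + 2)) \<noteq> 0"
    using ratio_solutions_Re_le(1)[of "of_real (b + 2)" b] assms(2) by (auto simp: ratio_solutions_def)
  moreover have "open ?S" by (intro open_Diff) auto
  moreover have "connected ?S"
  proof (rule connected_open_diff_countable)
    show "countable (\<int>\<^sub>\<le>\<^sub>0 :: complex set)"
      by (rule countable_subset[of _ "range of_int"]) (auto elim!: nonpos_Ints_cases)
  qed auto
  moreover have "?f holomorphic_on ?S"
    unfolding gamma_ratio_def by (intro holomorphic_intros) auto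
  ultimately have "eventually (\<lambda>u. ?f u \<noteq> 0 \<and> u \<in> ?S) (at w)"
    using assms(1) by (intro non_zero_neighbour_alt) auto
  then show ?thesis by eventually_elim auto
qed

lemma ratio_order_pos:
  assumes "w \<in> ratio_solutions b" "b > 0"
  shows   "ratio_order b w > 0"
proof -
  have w: "w \<notin> \<int>\<^sub>\<le>\<^sub>0" using assms(1) by (simp add: ratio_solutions_def)
  have "frequently (\<lambda>u. gamma_ratio (of_real b) u - of_real (gamma_ratio b (b + 1)) \<noteq> 0) (at w)"
    using eventually_not_ratio_solution[OF w assms(2)]
    by (intro eventually_frequently) (auto elim: eventually_mono)
  then show ?thesis
    unfolding ratio_order_def using assms(1) w
    by (subst zorder_pos_iff') (auto simp: ratio_solutions_def intro!: analytic_intros analytic_gamma_ratio)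
qed

lemma ratio_order_eq:
  assumes "w \<in> ratio_solutions b" "b > 0"
  shows   "ratio_order b w = zorder (\<lambda>u. cleared_ratio (of_real b) K u - of_real (gamma_ratio b (b + 1)) * pochhammer u (Suc K)) w"
    (is "_ = zorder ?H w")
proof -
  let ?f = "\<lambda>u. gamma_ratio (of_real b) u - of_real (gamma_ratio b (b + 1))"
  have w: "w \<notin> \<int>\<^sub>\<le>\<^sub>0" using assms(1) by (simp add: ratio_solutions_def)
  note ev = eventually_not_ratio_solution[OF w assms(2)]
  have an: "(\<lambda>u. pochhammer u (Suc K)) analytic_on {w}"
    unfolding pochhammer_prod by (intro analytic_intros)
  have "zorder ?H w = zorder (\<lambda>u. ?f u * pochhammer u (Suc K)) w"
    using ev by (intro zorder_cong refl) (auto elim!: eventually_mono simp: cleared_ratio_eq algebra_simps)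
  also have "\<dots> = zorder ?f w + zorder (\<lambda>u. pochhammer u (Suc K)) w"
  proof (rule zorder_times_analytic)
    show "?f analytic_on {w}" by (intro analytic_intros analytic_gamma_ratio w)
    show "eventually (\<lambda>u. ?f u * pochhammer u (Suc K) \<noteq> 0) (at w)"
      using ev by eventually_elim (auto dest: pochhammer_eq_0_imp_nonpos_Int)
  qed (fact an)
  also have "zorder (\<lambda>u. pochhammer u (Suc K)) w = 0"
    using w by (intro zorder_eq_0I an) (auto dest: pochhammer_eq_0_imp_nonpos_Int)
  finally show ?thesis by (simp add: ratio_order_def)
qed

text \<open>
  Rouche's theorem on the rectangle with real parts between \<open>-K - 1/2\<close> and \<open>b + 2\<close>, for
  \<open>(r - c) P\<close> against \<open>-c P\<close> with \<open>P(w) = w (w + 1) \<cdots> (w + K)\<close>. The polynomial has the \<open>K + 1\<close> simple zeros \<open>0, \<dots>, -K\<close>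
  there, and the rectangle is high enough to contain every solution to the right of its left edge.
\<close>
theorem sum_ratio_order:
  assumes "b > 1" "b \<notin> \<int>"
  obtains K0 :: nat where
    "\<And>K. K \<ge> K0 \<Longrightarrow> finite {w \<in> ratio_solutions b. Re w > - real K - 1/2}"
    "\<And>K. K \<ge> K0 \<Longrightarrow> (\<Sum>w | w \<in> ratio_solutions b \<and> Re w > - real K - 1/2. ratio_order b w) = int K + 1"
proof -
  define c where "c = gamma_ratio b (b + 1)"
  have c: "c > 0" using assms unfolding c_def by (intro gamma_ratio_pos) auto
  have b: "complex_of_real b \<notin> \<int>" using assms by simp
  obtain T where T: "T \<ge> 1" "\<And>w. \<bar>Im w\<bar> \<ge> T \<Longrightarrow> norm (gamma_ratio (of_real b) w) < c"
    using norm_gamma_ratio_less_if_Im_large[OF assms(1) c] by blast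
  obtain K0 :: nat where K0: "\<And>K w. K \<ge> K0 \<Longrightarrow> Re w = - real K - 1/2 \<Longrightarrow> norm (gamma_ratio (of_real b) w) < c"
    using norm_gamma_ratio_less_if_Re_half_integer[OF assms(1) c] by blast
  have sol_Im: "\<bar>Im w\<bar> < T" if "w \<in> ratio_solutions b" for w
    using that T(2)[of w] c by (force simp: ratio_solutions_def c_def)
  have main: "finite {w \<in> ratio_solutions b. Re w > - real K - 1/2} \<and>
      (\<Sum>w | w \<in> ratio_solutions b \<and> Re w > - real K - 1/2. ratio_order b w) = int K + 1" if K: "K \<ge> K0" for K
  proof -
    define f where "f = (\<lambda>w::complex. - of_real c * pochhammer w (Suc K))"
    define g :: "complex \<Rightarrow> complex" where "g = cleared_ratio (of_real b) K"
    \<comment> \<open>The rectangle ends at \<open>-K - 1/2\<close> and the next pole is \<open>-K - 1\<close>. The open set \<open>S\<close> ends in between, so that the zeros of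
      \<open>f + g\<close> in it lie in a compact subset of \<open>S'\<close>, where the function is holomorphic, and are finite in number.\<close>
    define S where "S = {w. Re w > - real K - 3/4}"
    define S' where "S' = {w. Re w > - real K - 1}"
    define p q where "p = Complex (- real K - 1/2) (-T)" and "q = Complex (b + 2) T"
    have holS': "(\<lambda>w. f w + g w) holomorphic_on S'" "f holomorphic_on S'" "g holomorphic_on S'"
      unfolding f_def g_def S'_def by (intro holomorphic_intros holomorphic_cleared_ratio)+
    have SS': "S \<subseteq> S'" by (auto simp: S_def S'_def)
    have zero_iff: "f w + g w = 0 \<longleftrightarrow> w \<in> ratio_solutions b" if "w \<in> S'" for w
      using cleared_ratio_eq_iff[OF b, of K w "of_real c"] that
      by (auto simp: f_def g_def S'_def ratio_solutions_def c_def algebra_simps)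
    have fg0: "f 0 + g 0 \<noteq> 0"
      using zero_iff[of 0] by (auto simp: S'_def ratio_solutions_def)
    have fin_fg: "finite {w\<in>S. f w + g w = 0}"
    proof (rule finite_subset)
      let ?B = "cbox (Complex (- real K - 3/4) (-T)) q"
      show "{w\<in>S. f w + g w = 0} \<subseteq> {w\<in>?B. f w + g w = 0}"
      proof (intro subsetI CollectI conjI; elim CollectE conjE)
        fix w assume w: "w \<in> S" "f w + g w = 0"
        then have "w \<in> ratio_solutions b" using zero_iff SS' by blast
        from sol_Im[OF this] ratio_solutions_Re_le(1)[OF this] show "w \<in> ?B"
          using w assms by (auto simp: in_cbox_complex_iff q_def S_def)
      qed
      show "finite {w\<in>?B. f w + g w = 0}"
      proof (rule holomorphic_compact_finite_zeros[OF holS'(1)])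
        show "open S'" "connected S'" unfolding S'_def
          by (auto intro!: open_halfspace_Re_gt convex_connected convex_halfspace_Re_gt)
        show "?B \<subseteq> S'" by (auto simp: S'_def in_cbox_complex_iff)
        show "\<not> (\<lambda>w. f w + g w) constant_on S'"
        proof
          assume "(\<lambda>w. f w + g w) constant_on S'"
          then obtain y where y: "\<And>u. u \<in> S' \<Longrightarrow> f u + g u = y"
            unfolding constant_on_def by blast
          have "of_real (b + 1) \<in> S'" "0 \<in> S'" using assms by (auto simp: S'_def)
          from y[OF this(1)] y[OF this(2)] have "f 0 + g 0 = f (of_real (b + 1)) + g (of_real (b + 1))"
            by simp
          also have "\<dots> = 0"
            using assms zero_iff[of "of_real (b + 1)"]
            by (simp add: S'_def ratio_solutions_def not_nonpos_Int_if_Re_pos flip: gamma_ratio_of_real)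
          finally show False using fg0 by simp
        qed
      qed auto
    qed
    have zeros_f: "f w = 0 \<longleftrightarrow> w \<in> (\<lambda>k. - of_nat k) ` {..K}" for w
      unfolding f_def using c pochhammer_zeros[of w K] by simp
    have Kne: "w \<notin> \<int>\<^sub>\<le>\<^sub>0" if "w \<in> cbox p q - box p q" for w
    proof
      assume "w \<in> \<int>\<^sub>\<le>\<^sub>0"
      then obtain k where k: "w = - of_nat k" by (auto elim!: nonpos_Ints_cases')
      have "Im w = 0" "Re w = - real k" by (simp_all add: k)
      with that T assms have "real k = K + 1/2"
        by (auto simp: in_cbox_complex_iff in_box_complex_iff p_def q_def simp del: of_nat_Suc)
      then have "real (2 * k) = real (2 * K + 1)" by simp
      then have "2 * k = 2 * K + 1" by (simp only: of_nat_eq_iff)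
      then show False by presburger
    qed
    have bound: "norm (gamma_ratio (of_real b) w) < c" if w: "w \<in> cbox p q - box p q" for w
    proof -
      from w have "Im w = -T \<or> Im w = T \<or> Re w = - real K - 1/2 \<or> Re w = b + 2"
        by (simp add: in_cbox_complex_iff in_box_complex_iff p_def q_def) linarith
      then consider "\<bar>Im w\<bar> \<ge> T" | "Re w = - real K - 1/2" | "Re w = b + 2"
        by fastforce
      then show ?thesis
      proof cases
        case 3
        then show ?thesis unfolding c_def using assms
          by (intro norm_gamma_ratio_less_if_Re_large) auto
      qed (use T K0[OF K] in auto)
    qed
    have "(\<Sum>w | w \<in> box p q \<and> f w + g w = 0. zorder (\<lambda>w. f w + g w) w)
        = (\<Sum>w | w \<in> box p q \<and> f w = 0. zorder f w)"
    proof (rule Rouche_rectangle)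
      show "open S" "connected S" unfolding S_def
        by (auto intro!: open_halfspace_Re_gt convex_connected convex_halfspace_Re_gt)
      show "f holomorphic_on S" "g holomorphic_on S"
        using holS' SS' holomorphic_on_subset by blast+
      show "finite {w\<in>S. f w + g w = 0}" by fact
      show "finite {w\<in>S. f w = 0}" by (auto simp: zeros_f)
      show "Re p < Re q" "Im p < Im q" using assms T by (auto simp: p_def q_def)
      show "cbox p q \<subseteq> S" by (auto simp: S_def in_cbox_complex_iff p_def)
      fix w assume w: "w \<in> cbox p q - box p q"
      have "pochhammer w (Suc K) \<noteq> 0"
        using Kne[OF w] by (auto dest: pochhammer_eq_0_imp_nonpos_Int)
      then show "norm (g w) < norm (f w)"
        using bound[OF w] Kne[OF w] c by (simp add: f_def g_def cleared_ratio_eq norm_mult)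
    qed
    also have "{w. w \<in> box p q \<and> f w = 0} = (\<lambda>k. - of_nat k) ` {..K}"
      using assms T by (auto simp: zeros_f in_box_complex_iff p_def q_def)
    also have "(\<Sum>w\<in>(\<lambda>k. - of_nat k) ` {..K}. zorder f w) = (\<Sum>k\<le>K. 1)"
      unfolding f_def using c
      by (subst sum.reindex) (auto simp: inj_on_def zorder_pochhammer intro!: sum.cong)
    also have "{w. w \<in> box p q \<and> f w + g w = 0} = {w \<in> ratio_solutions b. Re w > - real K - 1/2}" (is "?A = ?D")
    proof (intro equalityI subsetI)
      fix w assume "w \<in> ?A"
      then show "w \<in> ?D" using zero_iff[of w]
        by (auto simp: in_box_complex_iff S'_def p_def)
    next
      fix w assume w: "w \<in> ?D"
      then show "w \<in> ?A" using zero_iff[of w] sol_Im[of w] ratio_solutions_Re_le(1)[of w b] assms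
        by (auto simp: in_box_complex_iff S'_def p_def q_def)
    qed
    also have "(\<Sum>w\<in>?D. zorder (\<lambda>w. f w + g w) w) = (\<Sum>w\<in>?D. ratio_order b w)"
      using assms
      by (intro sum.cong) (auto simp: f_def g_def c_def ratio_order_eq[where K = K] algebra_simps)
    finally have "(\<Sum>w\<in>?D. ratio_order b w) = int K + 1" by simp
    moreover have "?D \<subseteq> {w\<in>S. f w + g w = 0}" using zero_iff by (auto simp: S_def S'_def)
    ultimately show ?thesis using fin_fg finite_subset by blast
  qed
  then show ?thesis using that by blast
qed

section \<open>Real solutions\<close>

lemma of_real_in_ratio_solutions_iff:
  "of_real x \<in> ratio_solutions b \<longleftrightarrow> x \<notin> \<int>\<^sub>\<le>\<^sub>0 \<and> gamma_ratio b x = gamma_ratio b (b + 1)"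
  by (simp add: ratio_solutions_def gamma_ratio_of_real of_real_in_nonpos_Ints_iff)

text \<open>
  The ratio commutes with the embedding of the reals, so its complex derivative at a real point
  is the real one and in particular does not vanish.
\<close>
lemma ratio_order_real_simple:
  assumes "(gamma_ratio b has_real_derivative D) (at x)" "D \<noteq> 0" "of_real x \<in> ratio_solutions b"
  shows   "ratio_order b (of_real x) = 1"
proof -
  define f where "f = (\<lambda>u::complex. gamma_ratio (of_real b) u - of_real (gamma_ratio b (b + 1)))"
  have an: "f analytic_on {of_real x}"
    unfolding f_def gamma_ratio_def using assms(3)
    by (intro analytic_intros) (auto simp: ratio_solutions_def)
  then have "(f has_field_derivative deriv f (of_real x)) (at (of_real x))"
    using analytic_on_imp_differentiable_at field_differentiable_derivI by blast
  then have "((\<lambda>t. f (of_real t)) has_vector_derivative deriv f (of_real x)) (at x)"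
    by (rule has_vector_derivative_real_field)
  moreover have "(\<lambda>t. f (of_real t)) = (\<lambda>t. of_real (gamma_ratio b t - gamma_ratio b (b + 1)))"
    by (simp add: f_def gamma_ratio_of_real)
  moreover have "((\<lambda>t. complex_of_real (gamma_ratio b t - gamma_ratio b (b + 1))) has_vector_derivative of_real D) (at x)"
  proof (rule has_vector_derivative_of_real)
    show "((\<lambda>t. gamma_ratio b t - gamma_ratio b (b + 1)) has_real_derivative D) (at x)"
      using assms(1)
      by (auto intro!: derivative_eq_intros)
  qed
  ultimately have "deriv f (of_real x) = of_real D"
    using vector_derivative_unique_at by metis
  with assms(2) have "deriv f (of_real x) \<noteq> 0" by simp
  moreover have "f (of_real x) = 0" using assms(3) by (simp add: f_def ratio_solutions_def)
  ultimately have "\<And>i. i < nat 1 \<Longrightarrow> (deriv ^^ i) f (of_real x) = 0" "(deriv ^^ nat 1) f (of_real x) \<noteq> 0"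
    by auto
  from zorder_zero_eqI'[OF an this] have "zorder f (of_real x) = 1" by simp
  then show ?thesis by (simp add: ratio_order_def f_def)
qed

lemma real_reflection: "rGamma x * rGamma (1 - x) = sin (pi * x) / (pi::real)"
proof -
  have "complex_of_real (rGamma x * rGamma (1 - x)) = of_real (sin (pi * x) / pi)"
    using rGamma_reflection_complex[of "of_real x"]
    by (simp flip: rGamma_complex_of_real sin_of_real)
  then show ?thesis by (simp only: of_real_eq_iff)
qed

lemma gamma_ratio_reflect_real:
  fixes x b :: real
  assumes "1 - b - x \<notin> \<int>\<^sub>\<le>\<^sub>0" "x \<notin> \<int>\<^sub>\<le>\<^sub>0"
  shows   "gamma_ratio b x * sin (pi * x) = gamma_ratio b (1 - b - x) * sin (pi * (x + b))"
proof -
  have "1 - of_real b - of_real x \<notin> (\<int>\<^sub>\<le>\<^sub>0 :: complex set)"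
    using assms(1) by (metis of_real_1 of_real_diff of_real_in_nonpos_Ints_iff)
  then have "complex_of_real (gamma_ratio b x * sin (pi * x)) = of_real (gamma_ratio b (1 - b - x) * sin (pi * (x + b)))"
    using gamma_ratio_reflect[of "of_real b" "of_real x"] assms(2)
    by (simp add: of_real_in_nonpos_Ints_iff flip: gamma_ratio_of_real sin_of_real)
  then show ?thesis by (simp only: of_real_eq_iff)
qed

lemma no_nonpos_Int_between: "- real k - 1 < x \<Longrightarrow> x < - real k \<Longrightarrow> x \<notin> \<int>\<^sub>\<le>\<^sub>0"
  by (auto elim!: nonpos_Ints_cases')

text \<open>
  After clearing the poles, the values at the two ends of the gap differ by the factor \<open>b - k - 1\<close>, from
  \<open>rGamma u = u rGamma (u + 1)\<close>. This factor is negative beyond \<open>-b\<close>, so the intermediate value theorem applies.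
  It expresses that the residues at \<open>-k\<close> and \<open>-k - 1\<close> have the same sign.
\<close>
lemma solution_between_poles:
  fixes b :: real
  assumes "b \<notin> \<int>" "real k > b - 1"
  obtains x where "- real k - 1 < x" "x < - real k" "of_real x \<in> ratio_solutions b"
proof -
  define c where "c = gamma_ratio b (b + 1)"
  \<comment> \<open>Clearing the poles up to \<open>-k - 1\<close> makes the function continuous on the closed gap.\<close>
  define h where "h = (\<lambda>x. cleared_ratio b (Suc k) x - c * pochhammer x (Suc (Suc k)))"
  have cont: "continuous_on {- real k - 1..- real k} h"
    unfolding h_def cleared_ratio_def pochhammer_prod
    by (intro continuous_at_imp_continuous_on ballI continuous_intros) (auto elim!: nonpos_Ints_cases')
  have h0: "h (- real k - 1) = (b - real k - 1) * rGamma (b - real k)"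
    using rGamma_plus1[of "b - real k - 1"] pochhammer_of_nat_eq_0_iff[of "Suc k" "Suc (Suc k)", where 'a = real]
    by (simp add: h_def cleared_ratio_def algebra_simps minus_diff_commute)
  have h1: "h (- real k) = rGamma (b - real k)"
    using pochhammer_of_nat_eq_0_iff[of "k" "Suc (Suc k)", where 'a = real] Gamma_numeral[of "num.Bit0 num.One", where 'a = real]
    by (simp add: h_def cleared_ratio_def algebra_simps)
  have "b - real k \<notin> \<int>\<^sub>\<le>\<^sub>0"
    using assms(1) Ints_add[of "b - real k" "real k"] by (auto dest!: nonpos_Ints_Int)
  then have r: "rGamma (b - real k) \<noteq> 0" by (simp add: rGamma_eq_zero_iff)
  obtain x where x: "- real k - 1 \<le> x" "x \<le> - real k" "h x = 0"
  proof (cases "rGamma (b - real k) > 0")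
    case True
    then have "h (- real k - 1) \<le> 0" "0 \<le> h (- real k)"
      unfolding h0 h1 using assms(2) by (auto simp: mult_le_0_iff)
    from IVT'[OF this _ cont] that show ?thesis by auto
  next
    case False
    with r have "h (- real k) \<le> 0" "0 \<le> h (- real k - 1)"
      unfolding h0 h1 using assms(2) by (auto intro!: mult_nonpos_nonpos)
    from IVT2'[OF this _ cont] that show ?thesis by auto
  qed
  have "x \<noteq> - real k - 1" "x \<noteq> - real k"
    using x(3) r assms(2) h0 h1 by auto
  with x have x': "- real k - 1 < x" "x < - real k" by auto
  have n: "x \<notin> \<int>\<^sub>\<le>\<^sub>0" by (rule no_nonpos_Int_between[OF x'])
  then have "pochhammer x (Suc (Suc k)) \<noteq> 0" by (auto dest: pochhammer_eq_0_imp_nonpos_Int)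
  with x(3) n have "gamma_ratio b x = c" by (simp add: h_def cleared_ratio_eq)
  with that x' n show ?thesis by (simp add: of_real_in_ratio_solutions_iff c_def)
qed

text \<open>
  Here \<open>1 / \<bar>r(x)\<bar> = \<Gamma>(x + b) \<Gamma>(1 - x) \<bar>sin \<pi>x\<bar> / \<pi>\<close> by reflection. For \<open>x > -m\<close> the last factor is less
  than \<open>x + b\<close>, since \<open>sin \<pi>x = \<plusminus> sin \<pi>(x + m)\<close> and \<open>m < b\<close>; this absorbs the growth of \<open>\<Gamma>(x + b)\<close> near \<open>x = -b\<close>.
  What remains, \<open>\<Gamma>(x + b + 1) \<Gamma>(1 - x)\<close>, is at most \<open>\<Gamma>(b + 1)\<close>, and
  \<open>\<Gamma>(b + 1) \<le> \<Gamma>(2b + 1) / \<Gamma>(b + 1) = 1 / c\<close>. So \<open>\<bar>r(x)\<bar> > c\<close>.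
\<close>
lemma no_negative_solution_right_of:
  fixes b x :: real
  assumes "real m < b" "- real m < x" "x < 0" "x \<notin> \<int>\<^sub>\<le>\<^sub>0"
  shows   "gamma_ratio b x \<noteq> gamma_ratio b (b + 1)"
proof
  assume eq: "gamma_ratio b x = gamma_ratio b (b + 1)"
  have xb: "x + b > 0" "b > 0" using assms by auto
  have pos: "Gamma (1 - x) > 0" "Gamma (x + b) > 0" "Gamma (b + 1) > 0" "Gamma (2 * b + 1) > 0"
    using assms xb by auto
  \<comment> \<open>Shifting by the integer \<open>m\<close> makes the argument positive and smaller than \<open>\<pi> (x + b)\<close>.\<close>
  have "\<bar>sin (pi * x)\<bar> = \<bar>sin (pi * (x + real m))\<bar>"
    by (simp add: distrib_left sin_add abs_mult)
  also have "\<dots> \<le> \<bar>pi * (x + real m)\<bar>" by (rule abs_sin_x_le_abs_x)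
  also have "\<dots> = pi * (x + real m)" using assms by simp
  also have "\<dots> < pi * (x + b)" using assms by simp
  finally have sin: "\<bar>sin (pi * x)\<bar> / pi < x + b" by (simp add: divide_less_eq mult.commute)
  have "\<bar>rGamma x\<bar> = Gamma (1 - x) * (\<bar>sin (pi * x)\<bar> / pi)"
  proof -
    have "rGamma x = Gamma (1 - x) * (rGamma x * rGamma (1 - x))"
      using pos(1) by (simp add: rGamma_inverse_Gamma)
    also have "\<dots> = Gamma (1 - x) * (sin (pi * x) / pi)" by (simp only: real_reflection)
    finally show ?thesis using pos(1) by (simp add: abs_mult)
  qed
  also have "\<dots> < Gamma (1 - x) * (x + b)"
    using sin pos(1) by (intro mult_strict_left_mono) auto
  finally have "Gamma (x + b) * \<bar>rGamma x\<bar> < Gamma (x + b) * (Gamma (1 - x) * (x + b))"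
    using pos by simp
  also have "\<dots> = Gamma ((x + b) + 1) * Gamma ((- x) + 1)"
  proof -
    have "x + b \<notin> \<int>\<^sub>\<le>\<^sub>0" using xb by (auto elim!: nonpos_Ints_cases)
    then have "Gamma ((x + b) + 1) = (x + b) * Gamma (x + b)" by (rule Gamma_plus1)
    moreover have "Gamma ((- x) + 1) = Gamma (1 - x)" by (simp add: add.commute)
    ultimately show ?thesis by (simp only: ac_simps)
  qed
  also have "\<dots> \<le> Gamma (x + b + - x + 1)"
    using xb assms by (intro Gamma_mult_Gamma_le) auto
  also have "\<dots> = Gamma (b + 1)" by simp
  finally have "Gamma (b + 1) * (Gamma (x + b) * \<bar>rGamma x\<bar>) < Gamma (b + 1) * Gamma (b + 1)"
    using pos by simp
  also have "\<dots> \<le> Gamma (b + b + 1)" using xb by (intro Gamma_mult_Gamma_le) auto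
  also have "\<dots> = Gamma (b + 1) * (Gamma (x + b) * rGamma x)"
  proof -
    have "Gamma x \<noteq> 0" using assms(4) by (simp add: Gamma_eq_zero_iff)
    moreover have "Gamma x / Gamma (x + b) = Gamma (b + 1) / Gamma (b + b + 1)"
      using eq by (simp add: gamma_ratio_def rGamma_inverse_Gamma divide_inverse algebra_simps)
    ultimately show ?thesis
      using pos by (simp add: rGamma_inverse_Gamma frac_eq_eq nonzero_eq_divide_eq[symmetric] divide_inverse[symmetric] mult_ac)
  qed
  finally show False using pos by (simp add: mult_less_cancel_left_pos)
qed

section \<open>The gaps to the left of -b for even n\<close>

text \<open>
  The reflection formula on the gap \<open>(-k - 1, -k)\<close>. The parity of \<open>n\<close> enters through the sign of the quotient of sines.
\<close>
lemma gamma_ratio_left_gap: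
  fixes n k :: nat and \<theta> t :: real
  defines "b \<equiv> real n + 1 + \<theta>"
  assumes "even n" "0 < t" "t < 1" "\<theta> < 1" "k \<ge> n + 1"
  shows "gamma_ratio b (- real k - t) = gamma_ratio b (real k + 1 - b + t) * (sin (pi * (\<theta> - t)) / sin (pi * t))"
proof -
  have st: "sin (pi * t) > 0" using assms by (intro sin_gt_zero) auto
  have "real k \<ge> real n + 1" using assms(6) by linarith
  then have y: "real k + 1 - b + t > 0" using assms(3,5) by (simp add: b_def)
  have "pi * (- real k - t) = - (pi * t + real k * pi)" by (simp add: algebra_simps)
  then have 1: "sin (pi * (- real k - t)) = - ((-1) ^ k * sin (pi * t))"
    by (simp only: sin_minus sin_add cos_npi sin_npi) simp
  have "pi * (- real k - t + b) = pi * (\<theta> - t) + real (n + 1) * pi - real k * pi"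
    by (simp add: b_def algebra_simps)
  moreover have "(-1) ^ (n + 1) = (-1 :: real)" using assms(2) by simp
  ultimately have 2: "sin (pi * (- real k - t + b)) = - ((-1) ^ k * sin (pi * (\<theta> - t)))"
    by (simp only: sin_diff sin_add cos_npi sin_npi) simp
  have "- real k - t \<notin> \<int>\<^sub>\<le>\<^sub>0" using assms by (intro no_nonpos_Int_between[of k]) auto
  moreover have "1 - b - (- real k - t) \<notin> \<int>\<^sub>\<le>\<^sub>0" using y by (auto elim!: nonpos_Ints_cases)
  ultimately have "gamma_ratio b (- real k - t) * sin (pi * (- real k - t))
      = gamma_ratio b (1 - b - (- real k - t)) * sin (pi * (- real k - t + b))"
    by (intro gamma_ratio_reflect_real)
  then have "gamma_ratio b (- real k - t) * sin (pi * t) = gamma_ratio b (real k + 1 - b + t) * sin (pi * (\<theta> - t))"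
    unfolding 1 2 by (simp add: algebra_simps)
  then show ?thesis using st by (simp add: field_simps)
qed

text \<open>
  Both factors of the product are positive and strictly decreasing in \<open>t\<close>. For the quotient of sines, the numerator of
  the derivative is the constant \<open>-\<pi> sin \<pi>\<theta>\<close> by the addition theorem.
\<close>
lemma gamma_ratio_left_gap_deriv:
  fixes n k :: nat and \<theta> t :: real
  defines "b \<equiv> real n + 1 + \<theta>"
  assumes "even n" "0 < t" "t < \<theta>" "\<theta> < 1" "k \<ge> n + 1"
  obtains D where "((\<lambda>t. gamma_ratio b (- real k - t)) has_real_derivative D) (at t)" "D < 0"
proof -
  define y where "y = real k + 1 - b + t"
  have "real k \<ge> real n + 1" using assms(6) by linarith
  then have y: "y > 0" using assms(3,5) by (simp add: b_def y_def)
  have b: "b > 0" using assms by (simp add: b_def)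
  have st: "sin (pi * t) > 0" using assms by (intro sin_gt_zero) auto
  have sd: "sin (pi * (\<theta> - t)) > 0"
    using assms mult_strict_left_mono[of "\<theta> - t" 1 pi] by (intro sin_gt_zero) auto
  have s\<theta>: "sin (pi * \<theta>) > 0" using assms by (intro sin_gt_zero) auto
  obtain D where D: "(gamma_ratio b has_real_derivative D) (at y)" "D < 0"
    using gamma_ratio_deriv_neg[OF y b] .
  have 1: "((\<lambda>t. gamma_ratio b (real k + 1 - b + t)) has_real_derivative D) (at t)"
    using D(1) DERIV_shift[of "gamma_ratio b" D t "real k + 1 - b"] by (simp add: y_def add_ac)
  define q where "q = (sin (pi * (\<theta> - t)) * (pi * cos (pi * t)) + pi * cos (pi * (\<theta> - t)) * sin (pi * t)) / (sin (pi * t))\<^sup>2"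
  have 2: "((\<lambda>t. sin (pi * (\<theta> - t)) / sin (pi * t)) has_real_derivative - q) (at t)"
  proof (rule DERIV_cong)
    show "((\<lambda>t. sin (pi * (\<theta> - t)) / sin (pi * t)) has_real_derivative
        (- pi * cos (pi * (\<theta> - t)) * sin (pi * t) - sin (pi * (\<theta> - t)) * (pi * cos (pi * t))) / (sin (pi * t) * sin (pi * t))) (at t)"
      using st by (intro DERIV_divide) (auto intro!: derivative_eq_intros)
    show "(- pi * cos (pi * (\<theta> - t)) * sin (pi * t) - sin (pi * (\<theta> - t)) * (pi * cos (pi * t))) / (sin (pi * t) * sin (pi * t)) = - q"
      unfolding q_def power2_eq_square minus_divide_left by (rule arg_cong2[where f = "(/)"]) (simp_all only: algebra_simps)
  qed
  have "q = pi * sin (pi * \<theta>) / (sin (pi * t))\<^sup>2"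
  proof -
    have "pi * (\<theta> - t) + pi * t = pi * \<theta>" by (simp add: algebra_simps)
    then have "sin (pi * \<theta>) = sin (pi * (\<theta> - t)) * cos (pi * t) + cos (pi * (\<theta> - t)) * sin (pi * t)"
      by (metis sin_add)
    then show ?thesis unfolding q_def by (simp add: distrib_left mult_ac)
  qed
  then have q: "q > 0" using s\<theta> st by simp
  define E where "E = D * (sin (pi * (\<theta> - t)) / sin (pi * t)) + - q * gamma_ratio b y"
  have "((\<lambda>t. gamma_ratio b (real k + 1 - b + t) * (sin (pi * (\<theta> - t)) / sin (pi * t))) has_real_derivative E) (at t)"
    using DERIV_mult[OF 1 2] by (simp add: E_def y_def)
  then have "((\<lambda>t. gamma_ratio b (- real k - t)) has_real_derivative E) (at t)"
  proof (rule has_field_derivative_transform_within_open)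
    show "open {0<..<1::real}" "t \<in> {0<..<1}" using assms by auto
    show "gamma_ratio b (real k + 1 - b + t) * (sin (pi * (\<theta> - t)) / sin (pi * t)) = gamma_ratio b (- real k - t)"
      if "t \<in> {0<..<1}" for t
      using gamma_ratio_left_gap[of n t \<theta> k] assms that by (simp add: b_def)
  qed
  moreover have "E < 0"
    unfolding E_def using D(2) sd st q gamma_ratio_pos[OF y, of b] b
    by (intro add_neg_neg mult_neg_pos) auto
  ultimately show ?thesis using that by blast
qed

text \<open>
  For \<open>\<theta> \<le> t < 1\<close> the quotient of sines is not positive, while \<open>c\<close> is.
\<close>
lemma left_gap_solution_in_positive_part:
  fixes n k :: nat and \<theta> t :: real
  defines "b \<equiv> real n + 1 + \<theta>"
  assumes "even n" "0 < \<theta>" "\<theta> < 1" "k \<ge> n + 1" "0 < t" "t < 1"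
    and sol: "gamma_ratio b (- real k - t) = gamma_ratio b (b + 1)"
  shows "t < \<theta>"
proof (rule ccontr)
  assume "\<not> t < \<theta>"
  then have "sin (pi * (t - \<theta>)) \<ge> 0" using assms by (intro sin_ge_zero) (auto intro!: mult_left_le)
  then have "sin (pi * (\<theta> - t)) \<le> 0"
    using sin_minus[of "pi * (t - \<theta>)"] by (simp add: algebra_simps)
  moreover have "sin (pi * t) > 0" using assms by (intro sin_gt_zero) auto
  moreover have "gamma_ratio b (real k + 1 - b + t) > 0"
    using assms(3-7) by (intro gamma_ratio_pos) (auto simp: b_def)
  ultimately have "gamma_ratio b (real k + 1 - b + t) * (sin (pi * (\<theta> - t)) / sin (pi * t)) \<le> 0"
    by (intro mult_nonneg_nonpos divide_nonpos_pos) auto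
  then have "gamma_ratio b (- real k - t) \<le> 0"
    using gamma_ratio_left_gap[of n t \<theta> k] assms(2,4-7) by (simp add: b_def)
  moreover have "gamma_ratio b (b + 1) > 0" using assms(3) by (intro gamma_ratio_pos) (auto simp: b_def)
  ultimately show False using sol by simp
qed

lemma gamma_ratio_left_gap_antimono:
  fixes n k :: nat and \<theta> s t :: real
  defines "b \<equiv> real n + 1 + \<theta>"
  assumes "even n" "0 < \<theta>" "\<theta> < 1" "k \<ge> n + 1" "0 < s" "s < t" "t < \<theta>"
  shows "gamma_ratio b (- real k - t) < gamma_ratio b (- real k - s)"
proof (rule DERIV_neg_imp_decreasing[OF \<open>s < t\<close>])
  fix u assume "s \<le> u" "u \<le> t"
  then show "\<exists>d. ((\<lambda>t. gamma_ratio b (- real k - t)) has_real_derivative d) (at u) \<and> d < 0"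
    using gamma_ratio_left_gap_deriv[of n u \<theta> k] assms unfolding b_def
    by (metis less_le_trans le_less_trans)
qed

lemma left_gap_solution_simple:
  fixes n k :: nat and \<theta> x :: real
  defines "b \<equiv> real n + 1 + \<theta>"
  assumes "even n" "0 < \<theta>" "\<theta> < 1" "k \<ge> n + 1" "- real k - 1 < x" "x < - real k"
    and sol: "of_real x \<in> ratio_solutions b"
  shows "ratio_order b (of_real x) = 1"
proof -
  define t where "t = - real k - x"
  have "t < \<theta>"
    using left_gap_solution_in_positive_part[of n \<theta> k t] assms
    by (auto simp: of_real_in_ratio_solutions_iff t_def)
  then obtain D where D: "((\<lambda>t. gamma_ratio b (- real k - t)) has_real_derivative D) (at t)" "D < 0"
    using gamma_ratio_left_gap_deriv[of n t \<theta> k] assms unfolding b_def t_def by force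
  have "((\<lambda>t. gamma_ratio b (- real k - t)) \<circ> (\<lambda>x. - real k - x) has_real_derivative D * (-1)) (at x)"
  proof (rule DERIV_chain)
    show "((\<lambda>t. gamma_ratio b (- real k - t)) has_real_derivative D) (at (- real k - x))"
      using D(1) by (simp add: t_def)
    show "((\<lambda>x. - real k - x) has_real_derivative - 1) (at x)"
      by (auto intro!: derivative_eq_intros)
  qed
  then have "(gamma_ratio b has_real_derivative - D) (at x)" by (simp add: o_def)
  then show ?thesis using D(2) sol by (intro ratio_order_real_simple[of b "- D"]) auto
qed

text \<open>
  A real solution is positive, hence \<open>b + 1\<close> by monotonicity; or it lies in \<open>(-n - 1, 0)\<close>, which is impossible; or it lies
  in a gap further to the left, where monotonicity makes it the given one.
\<close>
lemma real_solutions_even: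
  fixes n K :: nat and \<theta> :: real and x :: "nat \<Rightarrow> real"
  defines "b \<equiv> real n + 1 + \<theta>"
  assumes "even n" "0 < \<theta>" "\<theta> < 1"
    and x: "\<And>k. k \<ge> n + 1 \<Longrightarrow> - real k - 1 < x k \<and> x k < - real k \<and> of_real (x k) \<in> ratio_solutions b"
    and u: "of_real u \<in> ratio_solutions b"
  shows "u = b + 1 \<or> (\<exists>k\<ge>n + 1. u = x k)"
proof -
  have b: "b > 0" using assms by (simp add: b_def)
  have eq: "gamma_ratio b u = gamma_ratio b (b + 1)" and nu: "u \<notin> \<int>\<^sub>\<le>\<^sub>0"
    using u by (auto simp: of_real_in_ratio_solutions_iff)
  show ?thesis
  proof (cases "u > 0")
    case True
    then show ?thesis
      using gamma_ratio_strict_antimono[of u "b + 1" b] gamma_ratio_strict_antimono[of "b + 1" u b] b eq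
      by (cases u "b + 1" rule: linorder_cases) auto
  next
    case False
    then have u0: "u < 0" using nu by (cases "u = 0") auto
    have un: "u \<le> - real (n + 1)"
    proof (rule ccontr)
      assume "\<not> u \<le> - real (n + 1)"
      then show False
        using no_negative_solution_right_of[of "n + 1" b u] eq nu u0 assms(3) by (auto simp: b_def)
    qed
    define k where "k = nat (- \<lceil>u\<rceil>)"
    have "\<lceil>u\<rceil> \<le> - int (n + 1)" using un by linarith
    then have k: "real k = - of_int \<lceil>u\<rceil>" "k \<ge> n + 1"
      by (auto simp: k_def)
    have "u \<noteq> - real k" using nu by auto
    then have uk: "- real k - 1 < u" "u < - real k"
      using k(1) le_of_int_ceiling[of u] of_int_ceiling_le_add_one[of u] ceiling_correct[of u] by linarith+
    define s t where "s = - real k - u" and "t = - real k - x k"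
    have xk: "- real k - 1 < x k" "x k < - real k" "gamma_ratio b (x k) = gamma_ratio b (b + 1)"
      using x[OF k(2)] by (auto simp: of_real_in_ratio_solutions_iff)
    have "s < \<theta>" "t < \<theta>"
      using left_gap_solution_in_positive_part[of n \<theta> k s] left_gap_solution_in_positive_part[of n \<theta> k t]
        assms(2-4) k(2) uk xk eq by (auto simp: s_def t_def b_def)
    then have "\<not> s < t" "\<not> t < s"
      using gamma_ratio_left_gap_antimono[of n \<theta> k s t] gamma_ratio_left_gap_antimono[of n \<theta> k t s] assms(2-4) k(2) uk xk eq
      by (auto simp: s_def t_def b_def)
    then have "u = x k" by (simp add: s_def t_def)
    then show ?thesis using k by blast
  qed
qed

section \<open>The nonreal solutions\<close>

text \<open>
  The \<open>K + 1\<close> solutions to the right of \<open>-K - 1/2\<close> minus the real ones. The bound \<open>n + 1\<close> does not depend on \<open>K\<close>, which makes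
  the set of nonreal solutions finite; then one \<open>K\<close> captures all of them at once.
\<close>
theorem nonreal_ratio_solutions:
  fixes n :: nat and \<theta> :: real
  defines "b \<equiv> real n + 1 + \<theta>"
  defines "N \<equiv> {w \<in> ratio_solutions b. w \<notin> \<real>}"
  assumes \<theta>: "0 < \<theta>" "\<theta> < 1"
  shows "finite N"
    and "even n \<Longrightarrow> (\<Sum>w\<in>N. ratio_order b w) = int n"
    and "odd n \<Longrightarrow> (\<Sum>w\<in>N. ratio_order b w) \<le> int n + 1"
    and "odd n \<Longrightarrow> (\<Sum>w\<in>N. ratio_order b w) = int n + 1 \<Longrightarrow> w \<in> ratio_solutions b \<Longrightarrow> w \<in> \<real> \<Longrightarrow> ratio_order b w = 1"
proof -
  have b1: "b > 1" using \<theta> by (simp add: b_def)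
  have bZ: "b \<notin> \<int>"
  proof
    assume "b \<in> \<int>"
    then have "b - (real n + 1) \<in> \<int>" by (intro Ints_diff Ints_add) auto
    then obtain m where "\<theta> = of_int m" by (auto simp: b_def elim: Ints_cases)
    with \<theta> show False by simp
  qed
  define sols where "sols = ratio_solutions b"
  define D where "D = (\<lambda>K::nat. {w \<in> sols. Re w > - real K - 1/2})"
  have pos: "ratio_order b w > 0" if "w \<in> sols" for w
    using ratio_order_pos that b1 by (simp add: sols_def)
  obtain K0 where K0: "\<And>K. K \<ge> K0 \<Longrightarrow> finite (D K)"
      "\<And>K. K \<ge> K0 \<Longrightarrow> (\<Sum>w\<in>D K. ratio_order b w) = int K + 1"
    using sum_ratio_order[OF b1 bZ] unfolding D_def sols_def mem_Collect_eq by blast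
  have "\<forall>k\<in>{n + 1..}. \<exists>x. - real k - 1 < x \<and> x < - real k \<and> of_real x \<in> sols"
  proof
    fix k assume "k \<in> {n + 1..}"
    then have "real k > b - 1" using \<theta> by (simp add: b_def)
    from solution_between_poles[OF bZ this] show "\<exists>x. - real k - 1 < x \<and> x < - real k \<and> of_real x \<in> sols" unfolding sols_def by blast
  qed
  from bchoice[OF this] obtain x where
    x: "\<And>k. k \<ge> n + 1 \<Longrightarrow> - real k - 1 < x k \<and> x k < - real k \<and> of_real (x k) \<in> sols"
    by auto
  have inj: "inj_on x {n + 1..}"
  proof (rule inj_onI)
    fix i j assume ij: "i \<in> {n + 1..}" "j \<in> {n + 1..}" "x i = x j"
    with x[of i] x[of j] have "real i < real j + 1" "real j < real i + 1" by auto
    then show "i = j" by linarith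
  qed
  have b_sol: "of_real (b + 1) \<in> sols"
    using b1 by (auto simp: sols_def of_real_in_ratio_solutions_iff elim!: nonpos_Ints_cases simp del: of_real_add)
  \<comment> \<open>The known real solutions: \<open>b + 1\<close> and one in each gap with \<open>n + 1 \<le> k < J\<close>.\<close>
  define X where "X = (\<lambda>J::nat. complex_of_real ` insert (b + 1) (x ` {n + 1..<J}))"
  have card_X: "int (card (X J)) = int J - int n" if "J \<ge> n + 1" for J
  proof -
    have "b + 1 \<notin> x ` {n + 1..<J}" using x b1 by force
    moreover have "card (x ` {n + 1..<J}) = J - (n + 1)"
      using inj by (subst card_image) (auto intro: inj_on_subset)
    ultimately have "card (insert (b + 1) (x ` {n + 1..<J})) = Suc (J - (n + 1))" by simp
    then show ?thesis
      unfolding X_def using that by (subst card_image) (auto simp: inj_on_def of_nat_diff)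
  qed
  have X_sub: "X J \<subseteq> {w \<in> D K. w \<in> \<real>}" if "J \<le> K" for J K
    using that x b_sol b1 by (force simp: X_def D_def)
  have fin_X: "finite (X J)" for J by (simp add: X_def)
  have split: "(\<Sum>w | w \<in> D K \<and> w \<in> N. ratio_order b w) + (\<Sum>w | w \<in> D K \<and> w \<in> \<real>. ratio_order b w) = int K + 1"
    if "K \<ge> K0" for K
  proof -
    have "D K = {w. w \<in> D K \<and> w \<in> N} \<union> {w. w \<in> D K \<and> w \<in> \<real>}"
      by (auto simp: N_def D_def sols_def)
    then have "(\<Sum>w\<in>D K. ratio_order b w) = (\<Sum>w\<in>{w. w \<in> D K \<and> w \<in> N} \<union> {w. w \<in> D K \<and> w \<in> \<real>}. ratio_order b w)"
      by simp
    also have "\<dots> = (\<Sum>w | w \<in> D K \<and> w \<in> N. ratio_order b w) + (\<Sum>w | w \<in> D K \<and> w \<in> \<real>. ratio_order b w)"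
      using K0(1)[OF that] by (intro sum.union_disjoint) (auto simp: N_def)
    finally show ?thesis using K0(2)[OF that] by simp
  qed
  have ge_card: "int (card A) \<le> (\<Sum>w\<in>A. ratio_order b w)" if "A \<subseteq> sols" for A
  proof -
    have "(\<Sum>w\<in>A. 1) \<le> (\<Sum>w\<in>A. ratio_order b w)"
      using pos that by (intro sum_mono) force
    then show ?thesis by simp
  qed
  have real_ge: "(\<Sum>w | w \<in> D K \<and> w \<in> \<real>. ratio_order b w) \<ge> int K - int n" if K: "K \<ge> K0" "K \<ge> n + 1" for K
  proof -
    have "card (X K) \<le> card {w \<in> D K. w \<in> \<real>}"
      using X_sub[of K K] K0(1)[OF K(1)] by (intro card_mono) auto
    then show ?thesis
      using ge_card[of "{w \<in> D K. w \<in> \<real>}"] card_X[OF K(2)] by (auto simp: D_def)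
  qed
  have D_mono: "K \<le> L \<Longrightarrow> D K \<subseteq> D L" for K L by (auto simp: D_def)
  have in_D: "\<exists>K\<ge>L. A \<subseteq> D K" if "finite A" "A \<subseteq> sols" for A L
  proof -
    obtain K where "Max (insert 0 ((\<lambda>w. - Re w) ` A)) < real K"
      using reals_Archimedean2 by blast
    then have "\<forall>w\<in>A. - Re w < real K" using that(1) by (subst (asm) Max_less_iff) auto
    then have "A \<subseteq> D (max K L)" using that(2) by (force simp: D_def)
    then show ?thesis by (intro exI[of _ "max K L"]) auto
  qed
  define M where "M = max K0 (n + 1)"
  show finN: "finite N"
  proof (rule ccontr)
    assume "infinite N"
    then obtain A where A: "A \<subseteq> N" "finite A" "card A = n + 2"
      using infinite_arbitrarily_large by blast
    then have "A \<subseteq> sols" by (auto simp: N_def sols_def)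
    with A(2) in_D[of A M] obtain K where K: "K \<ge> M" "A \<subseteq> D K" by blast
    have "card A \<le> card {w. w \<in> D K \<and> w \<in> N}"
      using A K K0(1)[of K] by (intro card_mono) (auto simp: M_def)
    also have "int \<dots> \<le> (\<Sum>w | w \<in> D K \<and> w \<in> N. ratio_order b w)"
      by (intro ge_card) (auto simp: D_def)
    also have "\<dots> \<le> int n + 1"
      using split[of K] real_ge[of K] K by (simp add: M_def)
    finally show False using A by simp
  qed
  have "N \<subseteq> sols" by (auto simp: N_def sols_def)
  with finN obtain K1 where K1: "K1 \<ge> M" "N \<subseteq> D K1" using in_D[of N M] by blast
  have N_sum: "(\<Sum>w\<in>N. ratio_order b w) + (\<Sum>w | w \<in> D K \<and> w \<in> \<real>. ratio_order b w) = int K + 1" if "K \<ge> K1" for K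
  proof -
    have "{w. w \<in> D K \<and> w \<in> N} = N" using K1(2) D_mono[OF that] by auto
    then show ?thesis using split[of K] K1 that by (simp add: M_def)
  qed
  show "(\<Sum>w\<in>N. ratio_order b w) \<le> int n + 1"
    using N_sum[of K1] real_ge[of K1] K1 by (simp add: M_def)
  show "(\<Sum>w\<in>N. ratio_order b w) = int n" if "even n"
  proof -
    have c: "gamma_ratio b (b + 1) > 0" using b1 by (intro gamma_ratio_pos) auto
    obtain K2 where K2: "\<And>K w. K \<ge> K2 \<Longrightarrow> Re w = - real K - 1/2 \<Longrightarrow> norm (gamma_ratio (of_real b) w) < gamma_ratio b (b + 1)"
      using norm_gamma_ratio_less_if_Re_half_integer[OF b1 c] by blast
    define K where "K = max K1 K2"
    have K: "K \<ge> K0" "K \<ge> n + 1" "K \<ge> K1" "K \<ge> K2" using K1 by (auto simp: K_def M_def)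
    \<comment> \<open>The solution in the gap left of \<open>-K\<close> is inside the rectangle: otherwise monotonicity would give
      \<open>r(-K - 1/2) \<ge> c\<close>, but the ratio is small on that edge.\<close>
    have xK: "x K > - real K - 1/2"
    proof (rule ccontr)
      assume "\<not> x K > - real K - 1/2"
      moreover have sol: "gamma_ratio b (x K) = gamma_ratio b (b + 1)"
        using x[OF K(2)] by (simp add: sols_def of_real_in_ratio_solutions_iff)
      moreover have "- real K - x K < \<theta>"
        using left_gap_solution_in_positive_part[of n \<theta> K "- real K - x K"] that \<theta> K(2) x[OF K(2)] sol
        by (auto simp: b_def)
      ultimately have "gamma_ratio b (x K) \<le> gamma_ratio b (- real K - 1/2)"
        using gamma_ratio_left_gap_antimono[of n \<theta> K "1/2" "- real K - x K"] that \<theta> K(2)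
        by (cases "x K = - real K - 1/2") (auto simp: b_def)
      moreover have "\<bar>gamma_ratio b (- real K - 1/2)\<bar> < gamma_ratio b (b + 1)"
        using K2[OF K(4), of "of_real (- real K - 1/2)"]
        unfolding gamma_ratio_of_real norm_of_real Re_complex_of_real by blast
      ultimately show False using sol by linarith
    qed
    have R: "{w \<in> D K. w \<in> \<real>} = X (K + 1)"
    proof (intro equalityI subsetI)
      fix w assume w: "w \<in> X (K + 1)"
      have "{n + 1..<K + 1} = insert K {n + 1..<K}" using K(2) by auto
      then have "X (K + 1) = insert (of_real (x K)) (X K)" by (auto simp: X_def)
      then show "w \<in> {w \<in> D K. w \<in> \<real>}"
        using w X_sub[of K K] x[OF K(2)] xK by (auto simp: D_def)
    next
      fix w assume w: "w \<in> {w \<in> D K. w \<in> \<real>}"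
      then obtain u where u: "w = of_real u" by (auto elim: Reals_cases)
      with w have "of_real u \<in> ratio_solutions b" "u > - real K - 1/2" by (auto simp: D_def sols_def)
      then have "u = b + 1 \<or> (\<exists>k\<ge>n + 1. u = x k)"
        using real_solutions_even[of n \<theta> x u] that \<theta> x by (simp add: b_def sols_def)
      moreover have "k < K + 1" if "k \<ge> n + 1" "u = x k" for k
        using x[OF that(1)] that(2) \<open>u > - real K - 1/2\<close> by linarith
      ultimately show "w \<in> X (K + 1)" unfolding X_def u by auto
    qed
    have simple: "ratio_order b w = 1" if w: "w \<in> X (K + 1)" for w
    proof -
      from w consider "w = of_real (b + 1)" | k where "k \<ge> n + 1" "w = of_real (x k)"
        unfolding X_def by auto
      then show ?thesis
      proof cases
        case 1
        obtain E where "(gamma_ratio b has_real_derivative E) (at (b + 1))" "E < 0"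
          using gamma_ratio_deriv_neg[of "b + 1" b] b1 by auto
        then show ?thesis
          unfolding 1 using b_sol by (intro ratio_order_real_simple[where D = E]) (auto simp: sols_def)
      next
        case 2
        then show ?thesis
          using left_gap_solution_simple[of n \<theta> k "x k"] \<open>even n\<close> \<theta> x[of k] by (simp add: b_def sols_def)
      qed
    qed
    have "(\<Sum>w | w \<in> D K \<and> w \<in> \<real>. ratio_order b w) = int (card (X (K + 1)))"
      unfolding R using simple by simp
    then show ?thesis using N_sum[OF K(3)] card_X[of "K + 1"] K(2) by simp
  qed
  show "ratio_order b w = 1"
    if eq: "(\<Sum>w\<in>N. ratio_order b w) = int n + 1" and w: "w \<in> ratio_solutions b" "w \<in> \<real>"
  proof -
    obtain K where K: "K \<ge> K1" "w \<in> D K"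
      using in_D[of "{w}" K1] w by (auto simp: sols_def)
    let ?R = "{w. w \<in> D K \<and> w \<in> \<real>}"
    have fin: "finite ?R" using K0(1)[of K] K K1 by (simp add: M_def)
    have "(\<Sum>w\<in>?R. ratio_order b w) = int K - int n" using N_sum[OF K(1)] eq by simp
    moreover have "int (card ?R) \<ge> int K - int n"
      using card_mono[OF fin, of "X K"] X_sub[of K K] card_X[of K] K K1 by (auto simp: M_def)
    ultimately have "(\<Sum>w\<in>?R. ratio_order b w - 1) \<le> 0"
      by (simp add: sum_subtractf)
    moreover have nonneg: "ratio_order b w - 1 \<ge> 0" if "w \<in> ?R" for w
      using pos[of w] that by (auto simp: D_def)
    ultimately have "(\<Sum>w\<in>?R. ratio_order b w - 1) = 0"
      by (intro antisym sum_nonneg) auto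
    then have "\<forall>w\<in>?R. ratio_order b w - 1 = 0"
      using fin nonneg by (subst (asm) sum_nonneg_eq_0_iff) auto
    then show ?thesis using K(2) w by auto
  qed
qed

section \<open>From the ratio to the zeros of phi\<close>

text \<open>
  The difference of Beta values, with its value at the removable singularities not yet corrected, in terms
  of the ratio with \<open>b = \<beta> + 1\<close>.
\<close>
definition beta_difference :: "real \<Rightarrow> complex \<Rightarrow> complex" where
  "beta_difference \<beta> z = of_real (Gamma (\<beta> + 1)) *
     (of_real (gamma_ratio (\<beta> + 1) (\<beta> + 2)) - gamma_ratio (of_real (\<beta> + 1)) (z + of_real (\<beta> + 2)))"

lemma phi_eq_remove_sings: "phi \<beta> = remove_sings (beta_difference \<beta>)"
proof -
  have "of_real (gamma_ratio (\<beta> + 1) (\<beta> + 2)) = gamma_ratio (of_real (\<beta> + 1)) (complex_of_real (\<beta> + 2))"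
    by (simp only: gamma_ratio_of_real)
  moreover have "of_real (Gamma (\<beta> + 1)) = (Gamma (of_real (\<beta> + 1)) :: complex)"
    by (simp only: Gamma_complex_of_real)
  ultimately have "beta_difference \<beta> = (\<lambda>z. Beta (of_real \<beta> + 2) (of_real \<beta> + 1) - Beta (z + of_real \<beta> + 2) (of_real \<beta> + 1))"
    by (simp add: fun_eq_iff beta_difference_def Beta_altdef gamma_ratio_def algebra_simps)
  then show ?thesis by (simp add: phi_def)
qed

lemma analytic_beta_difference:
  assumes "z + of_real (\<beta> + 2) \<notin> \<int>\<^sub>\<le>\<^sub>0"
  shows   "beta_difference \<beta> analytic_on {z}"
  unfolding beta_difference_def[abs_def] gamma_ratio_def
  by (intro analytic_intros) (use assms in auto)

lemma shifted_nonpos_Ints_isolated: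
  fixes z a :: complex
  obtains U where "open U" "z \<in> U" "\<And>u. u \<in> U - {z} \<Longrightarrow> u + a \<notin> \<int>\<^sub>\<le>\<^sub>0"
proof (rule that)
  let ?U = "- ((\<lambda>u. u + a) -` (\<int>\<^sub>\<le>\<^sub>0 - {z + a}))"
  show "open ?U"
    by (intro open_Compl closed_vimage closed_subset_Ints continuous_intros) (auto dest: nonpos_Ints_Int)
  show "u + a \<notin> \<int>\<^sub>\<le>\<^sub>0" if "u \<in> ?U - {z}" for u using that by auto
qed auto

lemma isolated_singularity_beta_difference: "isolated_singularity_at (beta_difference \<beta>) z"
proof -
  obtain U where U: "open U" "z \<in> U" "\<And>u. u \<in> U - {z} \<Longrightarrow> u + of_real (\<beta> + 2) \<notin> \<int>\<^sub>\<le>\<^sub>0"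
    using shifted_nonpos_Ints_isolated[of z "of_real (\<beta> + 2)"] by blast
  have "beta_difference \<beta> analytic_on (U - {z})"
    using analytic_beta_difference U(3) by (subst analytic_on_analytic_at) auto
  then have "beta_difference \<beta> holomorphic_on (U - {z})" by (rule analytic_imp_holomorphic)
  then show ?thesis using U by (intro isolated_singularity_at_holomorphic)
qed

lemma zeros_iff_ratio_solution:
  assumes "\<beta> > 0" "z + of_real (\<beta> + 2) \<notin> \<int>\<^sub>\<le>\<^sub>0"
  shows   "z \<in> zeros \<beta> \<longleftrightarrow> z + of_real (\<beta> + 2) \<in> ratio_solutions (\<beta> + 1)"
proof -
  have "Gamma (\<beta> + 1) > 0" using assms(1) by (intro Gamma_real_pos) auto
  moreover have "\<not> is_pole (phi \<beta>) z" "phi \<beta> z = beta_difference \<beta> z"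
    using analytic_beta_difference[OF assms(2)]
    by (simp_all add: phi_eq_remove_sings isolated_singularity_at_analytic analytic_at_imp_no_pole)
  ultimately show ?thesis
    using assms(2) by (auto simp: zeros_def ratio_solutions_def beta_difference_def add.assoc)
qed

lemma zorder_phi:
  assumes "\<beta> > 0" "z + of_real (\<beta> + 2) \<notin> \<int>\<^sub>\<le>\<^sub>0"
  shows   "zorder (phi \<beta>) z = ratio_order (\<beta> + 1) (z + of_real (\<beta> + 2))"
proof -
  define w where "w = z + of_real (\<beta> + 2)"
  have G: "Gamma (\<beta> + 1) > 0" using assms(1) by (intro Gamma_real_pos) auto
  let ?f = "\<lambda>u. gamma_ratio (of_real (\<beta> + 1)) u - of_real (gamma_ratio (\<beta> + 1) (\<beta> + 1 + 1))"
  have "zorder (phi \<beta>) z = zorder (beta_difference \<beta>) z"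
    using analytic_beta_difference[OF assms(2)]
    by (simp add: phi_eq_remove_sings isolated_singularity_at_analytic)
  also have "\<dots> = zorder (\<lambda>u. beta_difference \<beta> (u + z)) 0"
    by (rule zorder_shift)
  also have "(\<lambda>u. beta_difference \<beta> (u + z)) = (\<lambda>u. - of_real (Gamma (\<beta> + 1)) * ?f (u + w))"
    by (simp add: fun_eq_iff beta_difference_def w_def algebra_simps)
  also have "zorder \<dots> 0 = zorder (\<lambda>u. ?f (u + w)) 0"
    using G by (intro zorder_cmult) auto
  also have "\<dots> = zorder ?f w" by (rule zorder_shift[symmetric])
  finally show ?thesis by (simp add: ratio_order_def w_def)
qed

lemma nonreal_not_pole:
  fixes z :: complex
  assumes "z \<notin> \<real>"
  shows   "z + of_real x \<notin> \<int>\<^sub>\<le>\<^sub>0"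
proof
  assume "z + of_real x \<in> \<int>\<^sub>\<le>\<^sub>0"
  then obtain k where "z + of_real x = of_int k" by (auto elim: nonpos_Ints_cases)
  then have "z = of_real (of_int k - x)" by (simp add: algebra_simps)
  then show False using assms by simp
qed

lemma bij_nonreal_zeros:
  assumes "\<beta> > 0"
  shows   "bij_betw (\<lambda>z. z + of_real (\<beta> + 2)) (nonreal_zeros \<beta>) {w \<in> ratio_solutions (\<beta> + 1). w \<notin> \<real>}"
proof (rule bij_betw_byWitness[where f' = "\<lambda>w. w - of_real (\<beta> + 2)"])
  have real_iff: "z + of_real (\<beta> + 2) \<in> \<real> \<longleftrightarrow> z \<in> \<real>" for z :: complex
    by (simp add: complex_is_Real_iff)
  show "(\<lambda>z. z + of_real (\<beta> + 2)) ` nonreal_zeros \<beta> \<subseteq> {w \<in> ratio_solutions (\<beta> + 1). w \<notin> \<real>}"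
    using zeros_iff_ratio_solution[OF assms nonreal_not_pole] by (auto simp: nonreal_zeros_def real_iff simp del: of_real_add)
  show "(\<lambda>w. w - of_real (\<beta> + 2)) ` {w \<in> ratio_solutions (\<beta> + 1). w \<notin> \<real>} \<subseteq> nonreal_zeros \<beta>"
  proof
    fix z assume "z \<in> (\<lambda>w. w - of_real (\<beta> + 2)) ` {w \<in> ratio_solutions (\<beta> + 1). w \<notin> \<real>}"
    then have z: "z + of_real (\<beta> + 2) \<in> ratio_solutions (\<beta> + 1)" "z \<notin> \<real>"
      by (auto simp: complex_is_Real_iff simp del: of_real_add)
    then show "z \<in> nonreal_zeros \<beta>"
      using zeros_iff_ratio_solution[OF assms nonreal_not_pole[OF z(2)]] by (simp add: nonreal_zeros_def del: of_real_add)
  qed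
qed auto

lemma zorder_nonreal_zero:
  assumes "\<beta> > 0" "z \<in> nonreal_zeros \<beta>"
  shows   "zorder (phi \<beta>) z = ratio_order (\<beta> + 1) (z + of_real (\<beta> + 2))"
  using assms by (intro zorder_phi nonreal_not_pole) (auto simp: nonreal_zeros_def)

lemma num_nonreal_zeros_eq:
  assumes "\<beta> > 0"
  shows   "num_nonreal_zeros \<beta> = (\<Sum>w | w \<in> ratio_solutions (\<beta> + 1) \<and> w \<notin> \<real>. ratio_order (\<beta> + 1) w)"
  unfolding num_nonreal_zeros_def using bij_nonreal_zeros[OF assms]
  by (subst sum.reindex_bij_betw[symmetric]) (auto intro!: sum.cong simp: zorder_nonreal_zero assms)

text \<open>
  Conjugating the factorization \<open>f(w) = g(w) (w - z)^k\<close> with \<open>g(z) \<noteq> 0\<close> gives one of the same order at the conjugate point.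
\<close>
lemma zorder_cnj_cnj:
  assumes "f holomorphic_on S" "open S" "connected S" "z \<in> S" "\<exists>w\<in>S. f w \<noteq> 0"
  shows   "zorder (\<lambda>w. cnj (f (cnj w))) (cnj z) = zorder f z"
proof -
  define g where "g = zor_poly f z"
  define n where "n = zorder f z"
  from zorder_exist_zero[OF assms]
  have "(if f z = 0 then 0 < n else n = 0) \<and> (\<exists>r>0. cball z r \<subseteq> S \<and> g holomorphic_on cball z r \<and>
      (\<forall>w\<in>cball z r. f w = g w * (w - z) ^ nat n \<and> g w \<noteq> 0))"
    unfolding g_def n_def by blast
  then have n: "n \<ge> 0" and "\<exists>r>0. g holomorphic_on cball z r \<and>
      (\<forall>w\<in>cball z r. f w = g w * (w - z) ^ nat n \<and> g w \<noteq> 0)"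
    by (simp split: if_splits, blast)
  then obtain r where r: "r > 0" "g holomorphic_on cball z r"
      and eq: "\<And>w. w \<in> cball z r \<Longrightarrow> f w = g w * (w - z) ^ nat n" "\<And>w. w \<in> cball z r \<Longrightarrow> g w \<noteq> 0"
    by blast
  have ball: "cnj w \<in> ball z r" if "w \<in> ball (cnj z) r" for w
    using that complex_mod_cnj[of "cnj z - w"] by (simp add: dist_norm)
  have "zorder (\<lambda>w. cnj (f (cnj w))) (cnj z) = n"
  proof (rule zorder_eqI)
    have "cnj ` ball (cnj z) r \<subseteq> cball z r" using ball by force
    then have "g holomorphic_on cnj ` ball (cnj z) r" using r(2) holomorphic_on_subset by blast
    then show "cnj \<circ> g \<circ> cnj holomorphic_on ball (cnj z) r"
      by (intro holomorphic_on_compose_cnj_cnj) auto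
    show "(cnj \<circ> g \<circ> cnj) (cnj z) \<noteq> 0" using eq(2)[of z] r(1) by simp
    show "cnj (f (cnj w)) = (cnj \<circ> g \<circ> cnj) w * (w - cnj z) powi n" if "w \<in> ball (cnj z) r" for w
    proof -
      have "cnj w \<in> cball z r" using ball[OF that] by simp
      then show ?thesis using eq(1)[of "cnj w"] n by (simp add: power_int_def)
    qed
  qed (use r in auto)
  then show ?thesis by (simp add: n_def)
qed

lemma ratio_order_cnj:
  assumes "w \<notin> \<int>\<^sub>\<le>\<^sub>0" "b > 0"
  shows   "ratio_order b (cnj w) = ratio_order b w"
proof -
  let ?f = "\<lambda>u. gamma_ratio (of_real b) u - of_real (gamma_ratio b (b + 1))"
  have "?f analytic_on {w}" by (intro analytic_intros analytic_gamma_ratio assms)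
  then obtain r where r: "r > 0" "?f holomorphic_on ball w r"
    by (auto simp: analytic_on_def)
  have "eventually (\<lambda>u. u \<in> ball w r \<and> ?f u \<noteq> 0) (at w)"
    using eventually_not_ratio_solution[OF assms] eventually_at_in_open'[of "ball w r" w] r(1)
    by (auto elim: eventually_elim2)
  from eventually_happens[OF this] have ex: "\<exists>u\<in>ball w r. ?f u \<noteq> 0" by auto
  have "(\<lambda>u. cnj (?f (cnj u))) = ?f" by (simp add: cnj_gamma_ratio)
  then show ?thesis
    using zorder_cnj_cnj[OF r(2) _ _ _ ex] r(1) by (simp add: ratio_order_def)
qed

lemma nonreal_zeros_conjugate:
  assumes "\<beta> > 0" "z \<in> nonreal_zeros \<beta>"
  shows   "0 < zorder (phi \<beta>) z" "cnj z \<in> nonreal_zeros \<beta>" "zorder (phi \<beta>) (cnj z) = zorder (phi \<beta>) z"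
proof -
  define w where "w = z + of_real (\<beta> + 2)"
  have w: "w \<in> ratio_solutions (\<beta> + 1)" "w \<notin> \<real>" "w \<notin> \<int>\<^sub>\<le>\<^sub>0"
    using bij_betwE[OF bij_nonreal_zeros[OF assms(1)]] assms(2)
    by (auto simp: w_def ratio_solutions_def)
  show "0 < zorder (phi \<beta>) z"
    using ratio_order_pos[OF w(1)] assms by (simp add: zorder_nonreal_zero w_def)
  have "cnj w \<in> ratio_solutions (\<beta> + 1)"
    unfolding ratio_solutions_def
  proof (intro CollectI conjI)
    show "cnj w \<notin> \<int>\<^sub>\<le>\<^sub>0" using w(2) nonreal_not_pole[of "cnj w" 0] by (simp add: complex_is_Real_iff)
    show "gamma_ratio (of_real (\<beta> + 1)) (cnj w) = of_real (gamma_ratio (\<beta> + 1) (\<beta> + 1 + 1))"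
      using w(1) unfolding ratio_solutions_def
      by (simp only: cnj_gamma_ratio[symmetric] mem_Collect_eq complex_cnj_complex_of_real)
  qed
  moreover have cw: "cnj z + of_real (\<beta> + 2) = cnj w" by (simp add: w_def)
  ultimately have "cnj z \<in> zeros \<beta>"
    using zeros_iff_ratio_solution[OF assms(1), of "cnj z"] by (simp only: cw) (auto simp: ratio_solutions_def)
  then show cz: "cnj z \<in> nonreal_zeros \<beta>"
    using assms(2) by (auto simp: nonreal_zeros_def complex_is_Real_iff)
  show "zorder (phi \<beta>) (cnj z) = zorder (phi \<beta>) z"
    using zorder_nonreal_zero[OF assms(1) cz] zorder_nonreal_zero[OF assms] ratio_order_cnj[OF w(3), of "\<beta> + 1"] assms(1)
    by (simp only: cw w_def[symmetric])
qed

lemma Re_nonzero_zero_neg: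
  assumes "\<beta> > 0" "z \<in> nonzero_zeros \<beta>"
  shows   "Re z < 0"
proof (rule ccontr)
  assume z: "\<not> Re z < 0"
  define w where "w = z + of_real (\<beta> + 2)"
  have Re_w: "Re w \<ge> \<beta> + 2" using z by (simp add: w_def)
  then have "w \<notin> \<int>\<^sub>\<le>\<^sub>0" using assms(1) by (intro not_nonpos_Int_if_Re_pos) auto
  then have "w \<in> ratio_solutions (\<beta> + 1)"
    using zeros_iff_ratio_solution[OF assms(1), of z] assms(2) by (simp add: w_def nonzero_zeros_def)
  from ratio_solutions_Re_le[OF this] Re_w assms(1) have "w = of_real (\<beta> + 1 + 1)" by auto
  then have "z = 0" by (simp add: w_def)
  with assms(2) show False by (simp add: nonzero_zeros_def)
qed

text \<open>
  For noninteger \<open>\<beta>\<close> the poles of \<open>\<Gamma>(z + \<beta> + 2)\<close> are poles of the difference. This excludes the value 0 that the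
  function has there by convention.
\<close>
lemma not_zero_at_pole:
  assumes "\<beta> \<notin> \<int>" "\<beta> > 0" "z + of_real (\<beta> + 2) \<in> \<int>\<^sub>\<le>\<^sub>0"
  shows   "z \<notin> zeros \<beta>"
proof -
  define b where "b = complex_of_real (\<beta> + 1)"
  define w where "w = z + of_real (\<beta> + 2)"
  obtain k where k: "w = - of_nat k" using assms(3) by (auto simp: w_def elim!: nonpos_Ints_cases')
  have "b \<notin> \<int>"
  proof
    assume "b \<in> \<int>"
    then have "b - 1 \<in> \<int>" by (intro Ints_diff) auto
    with assms(1) show False by (simp add: b_def)
  qed
  then have "w + b \<notin> \<int>\<^sub>\<le>\<^sub>0"
    using Ints_diff[of "w + b" w] k by (auto dest!: nonpos_Ints_Int)
  then have rG: "rGamma (w + b) \<noteq> 0" by (simp add: rGamma_eq_zero_iff)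
  have "Gamma (\<beta> + 1) > 0" using assms(2) by (intro Gamma_real_pos) auto
  have "is_pole (\<lambda>u. Gamma (u + of_real (\<beta> + 2))) z"
  proof (rule is_pole_compose[of Gamma w])
    show "is_pole Gamma w" unfolding k by (rule is_pole_Gamma)
    show "(\<lambda>u. u + of_real (\<beta> + 2)) \<midarrow>z\<rightarrow> w" unfolding w_def by (intro tendsto_intros)
    show "eventually (\<lambda>u. u + of_real (\<beta> + 2) \<noteq> w) (at z)"
      unfolding w_def by (auto simp: eventually_at_filter)
  qed
  then have "is_pole (\<lambda>u. Gamma (u + of_real (\<beta> + 2)) * rGamma (u + of_real (\<beta> + 2) + b)) z"
    by (rule is_pole_mult_analytic_nonzero2) (use rG in \<open>auto intro!: analytic_intros simp: w_def\<close>)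
  then have "is_pole (\<lambda>u. gamma_ratio b (u + of_real (\<beta> + 2)) - of_real (gamma_ratio (\<beta> + 1) (\<beta> + 2))) z"
    by (simp add: is_pole_minus_const_iff gamma_ratio_def)
  then have "is_pole (\<lambda>u. - of_real (Gamma (\<beta> + 1)) * (gamma_ratio b (u + of_real (\<beta> + 2)) - of_real (gamma_ratio (\<beta> + 1) (\<beta> + 2)))) z"
    using \<open>Gamma (\<beta> + 1) > 0\<close> by (subst is_pole_cmult_iff) auto
  also have "(\<lambda>u. - of_real (Gamma (\<beta> + 1)) * (gamma_ratio b (u + of_real (\<beta> + 2)) - of_real (gamma_ratio (\<beta> + 1) (\<beta> + 2)))) = beta_difference \<beta>"
    by (simp add: fun_eq_iff beta_difference_def b_def algebra_simps)
  finally have pole: "is_pole (beta_difference \<beta>) z" .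
  moreover have "isolated_singularity_at (beta_difference \<beta>) z"
    by (rule isolated_singularity_beta_difference)
  ultimately show ?thesis by (simp add: zeros_def phi_eq_remove_sings)
qed

section \<open>Integer parameters\<close>

text \<open>
  On \<open>[-n, 0]\<close> each factor satisfies \<open>\<bar>x + i\<bar> \<le> n\<close>, and each factor on the right exceeds \<open>n\<close>.
\<close>
lemma abs_pochhammer_less:
  fixes x :: real
  assumes "- real n \<le> x" "x \<le> 0"
  shows   "\<bar>pochhammer x (Suc n)\<bar> < pochhammer (real n + 2) (Suc n)"
proof -
  have "\<bar>pochhammer x (Suc n)\<bar> = (\<Prod>i\<in>{0..<Suc n}. \<bar>x + real i\<bar>)"
    unfolding pochhammer_prod by (rule abs_prod)
  also have "\<dots> < (\<Prod>i\<in>{0..<Suc n}. real n + 2 + real i)"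
    using assms by (intro prod_mono_strict[of 0]) auto
  finally show ?thesis by (simp add: pochhammer_prod)
qed

lemma pochhammer_strict_mono:
  fixes x y :: real
  assumes "0 < x" "x < y"
  shows   "pochhammer x (Suc n) < pochhammer y (Suc n)"
  unfolding pochhammer_prod using assms by (intro prod_mono_strict[of 0]) auto

text \<open>
  To the left of \<open>-n\<close> the symmetry \<open>x \<mapsto> -n - x\<close> reduces to positive arguments, with the sign \<open>(-1)^(n + 1)\<close>.
\<close>
lemma real_pochhammer_solutions:
  fixes x :: real
  shows "pochhammer x (Suc n) = pochhammer (real n + 2) (Suc n) \<longleftrightarrow> x = real n + 2 \<or> odd n \<and> x = - 2 * real n - 2"
proof -
  have positive: "pochhammer y (Suc n) = pochhammer (real n + 2) (Suc n) \<longleftrightarrow> y = real n + 2" if "y > 0" for y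
    using pochhammer_strict_mono[of y "real n + 2" n] pochhammer_strict_mono[of "real n + 2" y n] that
    by (cases y "real n + 2" rule: linorder_cases) auto
  consider "x > 0" | "- real n \<le> x" "x \<le> 0" | "x < - real n" by linarith
  then show ?thesis
  proof cases
    case 1
    then show ?thesis using positive[of x] by auto
  next
    case 2
    then show ?thesis using abs_pochhammer_less[of n x] by auto
  next
    case 3
    have eq: "pochhammer x (Suc n) = (-1) ^ Suc n * pochhammer (- x - real n) (Suc n)"
      using pochhammer_minus[of "- x" "Suc n"] by (simp add: algebra_simps)
    have pos: "pochhammer (- x - real n) (Suc n) > 0" "pochhammer (real n + 2) (Suc n) > 0"
      using 3 by (auto intro!: pochhammer_pos)
    show ?thesis
    proof (cases "even n")
      case True
      then show ?thesis using 3 pos eq by auto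
    next
      case False
      then have "pochhammer x (Suc n) = pochhammer (- x - real n) (Suc n)" using eq by simp
      then show ?thesis using positive[of "- x - real n"] 3 False by auto
    qed
  qed
qed

text \<open>
  The polynomial \<open>w (w + 1) \<cdots> (w + n)\<close> in the variable \<open>z = w - n - 2\<close> of \<open>\<phi>\<close>.
\<close>
definition pochhammer_poly :: "nat \<Rightarrow> complex poly" where
  "pochhammer_poly n = (\<Prod>i\<le>n. [:of_nat n + 2 + of_nat i, 1:])"

lemma poly_pochhammer_poly: "poly (pochhammer_poly n) z = pochhammer (z + of_nat n + 2) (Suc n)"
  by (simp add: pochhammer_poly_def poly_prod pochhammer_prod atLeast0AtMost atLeastLessThanSuc_atLeastAtMost add_ac del: prod.atLeast0_lessThan_Suc prod.op_ivl_Suc)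

lemma degree_pochhammer_poly: "degree (pochhammer_poly n) = Suc n"
  unfolding pochhammer_poly_def by (subst degree_prod_eq_sum_degree) auto

text \<open>
  The Gauss-Lucas theorem for the real roots \<open>0, -1, \<dots>, -n\<close>: at a critical point \<open>w\<close> the sum of all \<open>1 / (w + i)\<close> vanishes.
  All its terms have an imaginary part of the same sign unless \<open>w\<close> is real, and are of the same sign
  unless \<open>w\<close> lies between the extreme roots.
\<close>
lemma critical_points_pochhammer:
  assumes "poly (pderiv (pochhammer_poly n)) z = 0" "poly (pochhammer_poly n) z \<noteq> 0"
  obtains x where "z + of_nat n + 2 = of_real x" "- real n \<le> x" "x \<le> 0"
proof
  define w where "w = z + of_nat n + 2"
  have "(\<Prod>i\<le>n. w + of_nat i) \<noteq> 0"
    using assms(2) by (simp add: pochhammer_poly_def poly_prod w_def add_ac)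
  then have nz: "w + of_nat i \<noteq> 0" if "i \<le> n" for i
    using that by auto
  have "poly (pderiv (pochhammer_poly n)) z = (\<Sum>i\<le>n. \<Prod>j\<in>{..n} - {i}. w + of_nat j)"
    unfolding pochhammer_poly_def by (simp add: pderiv_prod poly_sum poly_prod w_def pderiv_pCons add_ac)
  also have "\<dots> = (\<Sum>i\<le>n. (\<Prod>j\<le>n. w + of_nat j) * inverse (w + of_nat i))"
  proof (intro sum.cong refl)
    fix i assume "i \<in> {..n}"
    then show "(\<Prod>j\<in>{..n} - {i}. w + of_nat j) = (\<Prod>j\<le>n. w + of_nat j) * inverse (w + of_nat i)"
      using nz[of i] by (subst prod.remove[of "{..n}" i]) auto
  qed
  also have "\<dots> = (\<Prod>j\<le>n. w + of_nat j) * (\<Sum>i\<le>n. inverse (w + of_nat i))"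
    by (simp add: sum_distrib_left)
  finally have sum0: "(\<Sum>i\<le>n. inverse (w + of_nat i)) = 0"
    using assms(1) \<open>(\<Prod>i\<le>n. w + of_nat i) \<noteq> 0\<close> by simp
  have Im0: "Im w = 0"
  proof -
    have "0 = Im (\<Sum>i\<le>n. inverse (w + of_nat i))" using sum0 by simp
    also have "\<dots> = - Im w * (\<Sum>i\<le>n. 1 / (norm (w + of_nat i))\<^sup>2)"
      by (simp add: sum_distrib_left cmod_power2)
    finally have "Im w = 0 \<or> (\<Sum>i\<le>n. 1 / (norm (w + of_nat i))\<^sup>2) = 0" by auto
    moreover have "(\<Sum>i\<le>n. 1 / (norm (w + of_nat i))\<^sup>2) > 0"
      using nz by (intro sum_pos) auto
    ultimately show ?thesis by auto
  qed
  define x where "x = Re w"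
  have w: "w = of_real x" using Im0 by (simp add: x_def complex_eq_iff)
  then show "z + of_nat n + 2 = of_real (Re (z + of_nat n + 2))" by (simp add: w_def x_def)
  have nzx: "x + real i \<noteq> 0" if "i \<le> n" for i
    using nz[OF that] unfolding w by (metis of_real_0 of_real_add of_real_of_nat_eq)
  have "of_real (\<Sum>i\<le>n. inverse (x + real i)) = (0 :: complex)"
    using sum0 by (simp add: w)
  then have s: "(\<Sum>i\<le>n. inverse (x + real i)) = 0" by (simp only: of_real_eq_0_iff)
  show "- real n \<le> Re (z + of_nat n + 2)"
  proof (rule ccontr)
    assume "\<not> ?thesis"
    then have "x < - real n" by (simp add: x_def w_def)
    then have "(\<Sum>i\<le>n. - inverse (x + real i)) > 0"
      by (intro sum_pos) auto
    then show False using s by (simp add: sum_negf)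
  qed
  show "Re (z + of_nat n + 2) \<le> 0"
  proof (rule ccontr)
    assume "\<not> ?thesis"
    then have "x > 0" by (simp add: x_def w_def)
    then have "(\<Sum>i\<le>n. inverse (x + real i)) > 0"
      by (intro sum_pos) auto
    then show False using s by simp
  qed
qed

text \<open>
  Its roots are the zeros of \<open>\<phi>\<^sub>n\<close>.
\<close>
definition phi_zero_poly :: "nat \<Rightarrow> complex poly" where
  "phi_zero_poly n = pochhammer_poly n - [:of_real (pochhammer (real n + 2) (Suc n)):]"

lemma pochhammer_of_real: "pochhammer (of_real x) n = (of_real (pochhammer x n) :: complex)"
  by (simp add: pochhammer_prod)

lemma rsquarefree_phi_zero_poly: "rsquarefree (phi_zero_poly n)"
  unfolding rsquarefree_roots
proof (intro allI notI, elim conjE)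
  fix z assume z: "poly (phi_zero_poly n) z = 0" "poly (pderiv (phi_zero_poly n)) z = 0"
  define C where "C = pochhammer (real n + 2) (Suc n)"
  have C: "C > 0" unfolding C_def by (intro pochhammer_pos) auto
  have eq: "poly (pochhammer_poly n) z = of_real C"
    using z(1) by (simp add: phi_zero_poly_def C_def)
  moreover have "poly (pderiv (pochhammer_poly n)) z = 0"
    using z(2) by (simp add: phi_zero_poly_def pderiv_diff pderiv_pCons)
  ultimately obtain x where x: "z + of_nat n + 2 = of_real x" "- real n \<le> x" "x \<le> 0"
    using critical_points_pochhammer[of n z] C by auto
  have "pochhammer x (Suc n) = C"
    using eq unfolding poly_pochhammer_poly x(1) pochhammer_of_real of_real_eq_iff .
  then show False using abs_pochhammer_less[OF x(2,3)] by (simp add: C_def)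
qed

lemma phi_zero_poly_nonzero: "phi_zero_poly n \<noteq> 0"
  using rsquarefree_phi_zero_poly[of n] by (auto simp: rsquarefree_def)

lemma card_roots_phi_zero_poly: "card {z. poly (phi_zero_poly n) z = 0} = Suc n"
proof -
  have "degree (phi_zero_poly n) = Suc n"
    unfolding phi_zero_poly_def diff_conv_add_uminus
    by (subst degree_add_eq_left) (auto simp: degree_pochhammer_poly)
  moreover have "degree (phi_zero_poly n) = degree (\<Prod>z | poly (phi_zero_poly n) z = 0. [:- z, 1:])"
    using arg_cong[OF complex_poly_decompose_rsquarefree[OF rsquarefree_phi_zero_poly[of n]], of degree]
      phi_zero_poly_nonzero[of n] by simp
  moreover have "degree (\<Prod>z | poly (phi_zero_poly n) z = 0. [:- z, 1:]) = card {z. poly (phi_zero_poly n) z = 0}"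
    by (subst degree_prod_eq_sum_degree) auto
  ultimately show ?thesis by simp
qed

text \<open>
  The same function as a rational expression. It agrees with \<open>beta_difference\<close> except where both Gamma factors of the ratio
  have poles; those points include the zero \<open>-3n - 4\<close> for odd \<open>n\<close>.
\<close>
definition integer_phi :: "nat \<Rightarrow> complex \<Rightarrow> complex" where
  "integer_phi n z = fact n * (1 / of_real (pochhammer (real n + 2) (Suc n)) - 1 / poly (pochhammer_poly n) z)"

lemma gamma_ratio_nat:
  assumes "w \<notin> \<int>\<^sub>\<le>\<^sub>0"
  shows   "gamma_ratio (of_nat m) w = 1 / pochhammer w m"
  using pochhammer_Gamma[OF assms, of m]
  by (simp add: gamma_ratio_def rGamma_inverse_Gamma divide_inverse)

lemma phi_nat_eq: "phi (real n) = remove_sings (integer_phi n)"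
proof
  fix z :: complex
  obtain U where U: "open U" "z \<in> U" "\<And>u. u \<in> U - {z} \<Longrightarrow> u + of_real (real n + 2) \<notin> \<int>\<^sub>\<le>\<^sub>0"
    using shifted_nonpos_Ints_isolated[of z "of_real (real n + 2)"] by blast
  have eq: "beta_difference (real n) u = integer_phi n u" if "u \<in> U - {z}" for u
  proof -
    have n1: "real n + 1 = real (Suc n)" by simp
    have "gamma_ratio (real n + 1) (real n + 2) = 1 / pochhammer (real n + 2) (Suc n)"
      unfolding n1 by (rule gamma_ratio_nat) (auto elim!: nonpos_Ints_cases)
    moreover have "gamma_ratio (of_real (real n + 1)) (u + of_real (real n + 2)) = 1 / poly (pochhammer_poly n) u"
      using gamma_ratio_nat[OF U(3)[OF that], of "Suc n"]
      unfolding n1 poly_pochhammer_poly of_real_of_nat_eq by (simp add: add_ac)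
    moreover have "Gamma (real n + 1) = fact n" using Gamma_fact[of n] by (simp add: add.commute)
    ultimately show ?thesis by (simp add: beta_difference_def integer_phi_def)
  qed
  have "eventually (\<lambda>u. u \<in> U - {z}) (at z)"
    using U(1,2) by (intro eventually_at_in_open)
  then have "eventually (\<lambda>u. beta_difference (real n) u = integer_phi n u) (at z)"
    by eventually_elim (rule eq)
  then show "phi (real n) z = remove_sings (integer_phi n) z"
    unfolding phi_eq_remove_sings by (rule remove_sings_cong) simp
qed

lemma pole_integer_phi:
  assumes "poly (pochhammer_poly n) z = 0"
  shows   "is_pole (integer_phi n) z" "phi (real n) z = 0" "z \<notin> zeros (real n)"
proof -
  let ?P = "pochhammer_poly n"
  have P0: "?P \<noteq> 0" using degree_pochhammer_poly[of n] by auto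
  have fin: "finite {u. poly ?P u = 0}" using P0 by (rule poly_roots_finite)
  have op: "open (- ({u. poly ?P u = 0} - {z}))" using fin by (intro open_Compl finite_imp_closed) auto
  have ev: "eventually (\<lambda>u. poly ?P u \<noteq> 0) (at z)"
    using eventually_at_in_open[OF op, of z] by (auto elim: eventually_mono)
  have "is_pole (\<lambda>u. 1 / poly ?P u) z"
  proof (rule is_pole_divide)
    show "filterlim (poly ?P) (at 0) (at z)"
      unfolding filterlim_at using ev assms poly_isCont[of z ?P] by (simp add: isCont_def)
  qed auto
  then have "is_pole (\<lambda>u. 1 / poly ?P u - 1 / of_real (pochhammer (real n + 2) (Suc n))) z"
    by (simp only: is_pole_minus_const_iff)
  then have "is_pole (\<lambda>u. - fact n * (1 / poly ?P u - 1 / of_real (pochhammer (real n + 2) (Suc n)))) z"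
    by (subst is_pole_cmult_iff) auto
  also have "(\<lambda>u. - fact n * (1 / poly ?P u - 1 / of_real (pochhammer (real n + 2) (Suc n)))) = integer_phi n"
    by (simp add: fun_eq_iff integer_phi_def algebra_simps)
  finally show pole: "is_pole (integer_phi n) z" .
  then show "phi (real n) z = 0" by (simp add: phi_nat_eq)
  have "integer_phi n holomorphic_on - ({u. poly ?P u = 0} - {z}) - {z}"
    unfolding integer_phi_def[abs_def] by (intro holomorphic_intros) auto
  then have "isolated_singularity_at (integer_phi n) z"
    using op by (intro isolated_singularity_at_holomorphic) auto
  then show "z \<notin> zeros (real n)" using pole by (simp add: zeros_def phi_nat_eq)
qed

lemma regular_integer_phi:
  assumes "poly (pochhammer_poly n) z \<noteq> 0"
  shows   "phi (real n) z = integer_phi n z" "z \<in> zeros (real n) \<longleftrightarrow> poly (phi_zero_poly n) z = 0"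
    "zorder (phi (real n)) z = zorder (integer_phi n) z"
proof -
  have C: "pochhammer (real n + 2) (Suc n) > 0" by (intro pochhammer_pos) auto
  have "pochhammer_poly n \<noteq> 0" using assms by auto
  then have "open (- {u. poly (pochhammer_poly n) u = 0})"
    by (intro open_Compl finite_imp_closed poly_roots_finite)
  moreover have "integer_phi n holomorphic_on - {u. poly (pochhammer_poly n) u = 0}"
    unfolding integer_phi_def[abs_def] using C by (intro holomorphic_intros) auto
  ultimately have an: "integer_phi n analytic_on {z}"
    using assms analytic_at by blast
  then show phi: "phi (real n) z = integer_phi n z" by (simp add: phi_nat_eq)
  have "\<not> is_pole (phi (real n)) z"
    using an by (simp add: phi_nat_eq isolated_singularity_at_analytic analytic_at_imp_no_pole)
  then show "z \<in> zeros (real n) \<longleftrightarrow> poly (phi_zero_poly n) z = 0"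
    unfolding zeros_def phi using assms C
    by (auto simp: phi integer_phi_def phi_zero_poly_def)
  show "zorder (phi (real n)) z = zorder (integer_phi n) z"
    using an by (simp add: phi_nat_eq isolated_singularity_at_analytic)
qed

lemma zeros_nat: "zeros (real n) = {z. poly (phi_zero_poly n) z = 0}"
proof (intro set_eqI)
  fix z
  have "pochhammer (real n + 2) (Suc n) > 0" by (intro pochhammer_pos) auto
  then show "z \<in> zeros (real n) \<longleftrightarrow> z \<in> {z. poly (phi_zero_poly n) z = 0}"
    using regular_integer_phi(2)[of n z] pole_integer_phi(3)[of n z]
    by (cases "poly (pochhammer_poly n) z = 0") (auto simp: phi_zero_poly_def)
qed

text \<open>
  \<open>\<phi>\<^sub>n\<close> is its zero polynomial times a factor without zeros, and that polynomial is squarefree.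
\<close>
lemma simple_zero_nat:
  assumes "z \<in> zeros (real n)"
  shows   "simple_zero (real n) z"
proof -
  define C where "C = complex_of_real (pochhammer (real n + 2) (Suc n))"
  have "pochhammer (real n + 2) (Suc n) > 0" by (intro pochhammer_pos) auto
  then have C: "C \<noteq> 0" by (simp add: C_def)
  let ?P = "pochhammer_poly n"
  have root: "poly (phi_zero_poly n) z = 0" using assms by (simp add: zeros_nat)
  have Pz: "poly ?P z \<noteq> 0" using assms pole_integer_phi(3) by blast
  obtain q where q: "phi_zero_poly n = [:- z, 1:] * q"
    using root by (auto simp: poly_eq_0_iff_dvd elim: dvdE)
  have "poly (pderiv (phi_zero_poly n)) z \<noteq> 0"
    using rsquarefree_phi_zero_poly[of n] root unfolding rsquarefree_roots by blast
  then have qz: "poly q z \<noteq> 0" unfolding q pderiv_mult by (simp add: pderiv_pCons)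
  have P0: "?P \<noteq> 0" using degree_pochhammer_poly[of n] by auto
  have "zorder (integer_phi n) z = 1"
  proof (rule simple_zeroI)
    show "open (- {u. poly ?P u = 0})"
      by (intro open_Compl finite_imp_closed poly_roots_finite P0)
    show "z \<in> - {u. poly ?P u = 0}" using Pz by simp
    show "(\<lambda>u. fact n * poly q u / (C * poly ?P u)) holomorphic_on - {u. poly ?P u = 0}"
      using C by (intro holomorphic_intros) auto
    show "fact n * poly q z / (C * poly ?P z) \<noteq> 0" using C Pz qz by simp
    fix u assume u: "u \<in> - {u. poly ?P u = 0}"
    have "poly ?P u - C = (u - z) * poly q u"
      using arg_cong[OF q, of "\<lambda>p. poly p u"] by (simp add: phi_zero_poly_def C_def algebra_simps)
    moreover have "integer_phi n u = fact n * (poly ?P u - C) / (C * poly ?P u)"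
      using u C by (simp add: integer_phi_def C_def[symmetric] field_simps)
    ultimately show "integer_phi n u = fact n * poly q u / (C * poly ?P u) * (u - z)"
      by (simp add: mult_ac)
  qed
  then show ?thesis using regular_integer_phi(3)[OF Pz] assms by (simp add: simple_zero_def)
qed

lemma real_zero_nat_iff:
  "of_real x \<in> zeros (real n) \<longleftrightarrow> x = 0 \<or> odd n \<and> x = - 3 * real n - 4"
proof -
  have eq: "of_real x + of_nat n + 2 = complex_of_real (x + real n + 2)" by simp
  have "poly (phi_zero_poly n) (of_real x)
      = of_real (pochhammer (x + real n + 2) (Suc n)) - of_real (pochhammer (real n + 2) (Suc n))"
    unfolding phi_zero_poly_def poly_diff poly_pochhammer_poly eq pochhammer_of_real by simp
  then have "of_real x \<in> zeros (real n) \<longleftrightarrow> pochhammer (x + real n + 2) (Suc n) = pochhammer (real n + 2) (Suc n)"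
    unfolding zeros_nat by simp
  also have "\<dots> \<longleftrightarrow> x = 0 \<or> odd n \<and> x = - 3 * real n - 4"
    unfolding real_pochhammer_solutions by auto
  finally show ?thesis .
qed

lemma nonzero_zeros_nat:
  shows "finite (nonzero_zeros (real n))" "card (nonzero_zeros (real n)) = n"
proof -
  have "0 \<in> zeros (real n)" using real_zero_nat_iff[of 0 n] by simp
  moreover have "finite (zeros (real n))" unfolding zeros_nat by (intro poly_roots_finite phi_zero_poly_nonzero)
  moreover have "card (zeros (real n)) = Suc n" unfolding zeros_nat by (rule card_roots_phi_zero_poly)
  ultimately show "finite (nonzero_zeros (real n))" "card (nonzero_zeros (real n)) = n"
    by (simp_all add: nonzero_zeros_def)
qed

text \<open>
  At the poles of \<open>\<phi>\<^sub>n\<close> its value is 0 by convention. There \<open>1 / \<phi>\<^sub>n\<close> is 0 as well, in agreement with the numerator.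
\<close>
lemma rational_function_nat: "rational_function (\<lambda>z. 1 / phi (real n) z)"
  unfolding rational_function_def
proof (intro exI conjI allI impI)
  define C where "C = complex_of_real (pochhammer (real n + 2) (Suc n))"
  have "pochhammer (real n + 2) (Suc n) > 0" by (intro pochhammer_pos) auto
  then have C: "C \<noteq> 0" by (simp add: C_def)
  show "smult (fact n) (phi_zero_poly n) \<noteq> 0" using phi_zero_poly_nonzero by simp
  fix z assume q: "poly (smult (fact n) (phi_zero_poly n)) z \<noteq> 0"
  show "1 / phi (real n) z = poly (smult (of_real (pochhammer (real n + 2) (Suc n))) (pochhammer_poly n)) z / poly (smult (fact n) (phi_zero_poly n)) z"
  proof (cases "poly (pochhammer_poly n) z = 0")
    case True
    then show ?thesis using pole_integer_phi(2)[OF True] by simp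
  next
    case False
    then have "phi (real n) z = fact n * (poly (pochhammer_poly n) z - C) / (C * poly (pochhammer_poly n) z)"
      using C by (simp add: regular_integer_phi(1) integer_phi_def C_def[symmetric] field_simps)
    then show ?thesis by (simp add: phi_zero_poly_def C_def)
  qed
qed

section \<open>The zeros of phi\<close>

lemma finite_zeros_half_plane:
  assumes "\<beta> > 0" "\<beta> \<notin> \<int>"
  shows   "finite {\<rho> \<in> zeros \<beta>. - \<sigma> < Re \<rho>}"
proof -
  have b: "\<beta> + 1 > 1" "\<beta> + 1 \<notin> \<int>" using assms by (auto dest: Ints_diff[of "\<beta> + 1" 1])
  obtain K0 where K0: "\<And>K. K \<ge> K0 \<Longrightarrow> finite {w \<in> ratio_solutions (\<beta> + 1). Re w > - real K - 1/2}"
    using sum_ratio_order[OF b] by blast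
  obtain K where K: "\<sigma> < real K" using reals_Archimedean2 by blast
  let ?A = "{w \<in> ratio_solutions (\<beta> + 1). Re w > - real (max K K0) - 1/2}"
  have "{\<rho> \<in> zeros \<beta>. - \<sigma> < Re \<rho>} \<subseteq> (\<lambda>w. w - of_real (\<beta> + 2)) ` ?A"
  proof
    fix z assume z: "z \<in> {\<rho> \<in> zeros \<beta>. - \<sigma> < Re \<rho>}"
    then have "z + of_real (\<beta> + 2) \<notin> \<int>\<^sub>\<le>\<^sub>0" using not_zero_at_pole[OF assms(2,1)] by blast
    then have "z + of_real (\<beta> + 2) \<in> ratio_solutions (\<beta> + 1)"
      using zeros_iff_ratio_solution[OF assms(1)] z by blast
    moreover have "Re (z + of_real (\<beta> + 2)) > - real (max K K0) - 1/2"
    proof -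
      have "real K \<le> real (max K K0)" by simp
      moreover have "- \<sigma> < Re z" using z by simp
      ultimately have "- real (max K K0) - 1/2 < Re z + (\<beta> + 2)" using K assms(1) by linarith
      then show ?thesis by simp
    qed
    ultimately show "z \<in> (\<lambda>w. w - of_real (\<beta> + 2)) ` ?A"
      by (intro image_eqI[of _ _ "z + of_real (\<beta> + 2)"]) auto
  qed
  then show ?thesis by (rule finite_subset) (intro finite_imageI K0 max.cobounded2)
qed

lemma floor_decomposition:
  assumes "\<beta> > 0" "\<beta> \<notin> \<int>"
  obtains n :: nat and \<theta> where "\<beta> = real n + \<theta>" "0 < \<theta>" "\<theta> < 1"
proof (rule that[of "nat \<lfloor>\<beta>\<rfloor>" "frac \<beta>"])
  show "\<beta> = real (nat \<lfloor>\<beta>\<rfloor>) + frac \<beta>" using assms(1) by (simp add: frac_def)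
qed (use assms in \<open>auto simp: frac_lt_1 frac_gt_0_iff\<close>)

lemma noninteger_if_fractional:
  fixes n :: nat
  assumes "\<beta> = real n + \<theta>" "0 < \<theta>" "\<theta> < 1"
  shows   "\<beta> \<notin> \<int>"
proof
  assume "\<beta> \<in> \<int>"
  then have "\<beta> - real n \<in> \<int>" by (intro Ints_diff) auto
  then obtain k where "\<theta> = of_int k" using assms(1) by (auto elim: Ints_cases)
  with assms show False by simp
qed

lemma finite_nonreal_zeros:
  assumes "\<beta> > 0"
  shows   "finite (nonreal_zeros \<beta>)"
proof (cases "\<beta> \<in> \<int>")
  case True
  then obtain k where "\<beta> = of_int k" by (auto elim: Ints_cases)
  with assms have "\<beta> = real (nat k)" by simp
  then show ?thesis
    using nonzero_zeros_nat(1)[of "nat k"]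
    by (auto simp: nonreal_zeros_def nonzero_zeros_def elim!: rev_finite_subset)
next
  case False
  then obtain n :: nat and \<theta> where *: "\<beta> = real n + \<theta>" "0 < \<theta>" "\<theta> < 1"
    using floor_decomposition assms by blast
  then have "finite {w \<in> ratio_solutions (\<beta> + 1). w \<notin> \<real>}"
    using nonreal_ratio_solutions(1)[OF *(2,3), of n] by (simp add: add_ac)
  then show ?thesis using bij_betw_finite[OF bij_nonreal_zeros[OF assms]] by simp
qed

theorem theorem2p8:
  fixes \<beta> :: real
  assumes "\<beta> > 0"
  shows
    "(\<forall>\<rho>\<in>nonzero_zeros \<beta>. Re \<rho> < 0)
     \<and> finite (nonreal_zeros \<beta>)
     \<and> (\<forall>\<rho>\<in>nonreal_zeros \<beta>. 0 < zorder (phi \<beta>) \<rho>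
          \<and> cnj \<rho> \<in> nonreal_zeros \<beta> \<and> zorder (phi \<beta>) (cnj \<rho>) = zorder (phi \<beta>) \<rho>)
     \<and> (\<forall>n::nat. \<beta> = real n \<longrightarrow>
          rational_function (\<lambda>z. 1 / phi \<beta> z)
          \<and> finite (nonzero_zeros \<beta>) \<and> card (nonzero_zeros \<beta>) = n
          \<and> (\<forall>\<rho>\<in>nonzero_zeros \<beta>. simple_zero \<beta> \<rho>)
          \<and> (even n \<longrightarrow> (\<forall>\<rho>\<in>nonzero_zeros \<beta>. \<rho> \<notin> \<real>))
          \<and> (odd n \<longrightarrow> {\<rho> \<in> nonzero_zeros \<beta>. \<rho> \<in> \<real>} = {- 3 * of_nat n - 4}))
     \<and> (\<forall>(n::nat) \<theta>. \<beta> = real n + \<theta> \<and> 0 < \<theta> \<and> \<theta> < 1 \<longrightarrow>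
          (even n \<longrightarrow> num_nonreal_zeros \<beta> = int n)
          \<and> (odd n \<longrightarrow> num_nonreal_zeros \<beta> \<le> int n + 1
               \<and> (num_nonreal_zeros \<beta> = int n + 1 \<longrightarrow>
                    (\<forall>\<rho>\<in>zeros \<beta>. \<rho> \<in> \<real> \<longrightarrow> simple_zero \<beta> \<rho>))))
     \<and> (\<forall>\<sigma>>0. (\<forall>z\<in>zeros \<beta>. Re z \<noteq> - \<sigma>) \<longrightarrow>
          finite {\<rho> \<in> nonzero_zeros \<beta>. - \<sigma> < Re \<rho> \<and> Re \<rho> < 0})"
proof (intro conjI ballI allI impI)
  show "Re \<rho> < 0" if "\<rho> \<in> nonzero_zeros \<beta>" for \<rho>
    using Re_nonzero_zero_neg assms that by blast
  show "finite (nonreal_zeros \<beta>)" using finite_nonreal_zeros assms by blast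
  show "0 < zorder (phi \<beta>) \<rho>" "cnj \<rho> \<in> nonreal_zeros \<beta>" "zorder (phi \<beta>) (cnj \<rho>) = zorder (phi \<beta>) \<rho>"
    if "\<rho> \<in> nonreal_zeros \<beta>" for \<rho>
    using nonreal_zeros_conjugate[OF assms that] by blast+
next
  fix n :: nat assume \<beta>: "\<beta> = real n"
  show "rational_function (\<lambda>z. 1 / phi \<beta> z)" "finite (nonzero_zeros \<beta>)" "card (nonzero_zeros \<beta>) = n"
    unfolding \<beta> by (rule rational_function_nat nonzero_zeros_nat)+
  show "simple_zero \<beta> \<rho>" if "\<rho> \<in> nonzero_zeros \<beta>" for \<rho>
    using simple_zero_nat that unfolding \<beta> nonzero_zeros_def by blast
  have real_nonzero: "\<rho> \<in> nonzero_zeros \<beta> \<and> \<rho> \<in> \<real> \<longleftrightarrow> odd n \<and> \<rho> = - 3 * of_nat n - 4" for \<rho>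
  proof
    assume "\<rho> \<in> nonzero_zeros \<beta> \<and> \<rho> \<in> \<real>"
    then obtain x where "\<rho> = of_real x" "x \<noteq> 0" "of_real x \<in> zeros (real n)"
      by (auto simp: \<beta> nonzero_zeros_def elim!: Reals_cases)
    then show "odd n \<and> \<rho> = - 3 * of_nat n - 4" by (simp add: real_zero_nat_iff)
  next
    assume *: "odd n \<and> \<rho> = - 3 * of_nat n - 4"
    then have eq: "\<rho> = of_real (- 3 * real n - 4)" by simp
    have "- 3 * real n - 4 \<noteq> 0" by linarith
    then have "\<rho> \<noteq> 0" unfolding eq of_real_eq_0_iff .
    moreover have "\<rho> \<in> zeros \<beta>" unfolding eq \<beta> real_zero_nat_iff using * by simp
    moreover have "\<rho> \<in> \<real>" unfolding eq by simp
    ultimately show "\<rho> \<in> nonzero_zeros \<beta> \<and> \<rho> \<in> \<real>" by (simp add: nonzero_zeros_def)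
  qed
  show "\<rho> \<notin> \<real>" if "even n" "\<rho> \<in> nonzero_zeros \<beta>" for \<rho>
    using real_nonzero that by blast
  show "{\<rho> \<in> nonzero_zeros \<beta>. \<rho> \<in> \<real>} = {- 3 * of_nat n - 4}" if "odd n"
    using real_nonzero that by blast
next
  fix n :: nat and \<theta> :: real
  assume *: "\<beta> = real n + \<theta> \<and> 0 < \<theta> \<and> \<theta> < 1"
  have b: "\<beta> + 1 = real n + 1 + \<theta>" using * by simp
  note nonreal = nonreal_ratio_solutions[of \<theta> n, folded b]
  note num = num_nonreal_zeros_eq[OF assms]
  show "num_nonreal_zeros \<beta> = int n" if "even n" using nonreal(2) * that num by simp
  show "num_nonreal_zeros \<beta> \<le> int n + 1" if "odd n" using nonreal(3) * that num by simp
  show "simple_zero \<beta> \<rho>"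
    if "odd n" "num_nonreal_zeros \<beta> = int n + 1" "\<rho> \<in> zeros \<beta>" "\<rho> \<in> \<real>" for \<rho>
  proof -
    have regular: "\<rho> + of_real (\<beta> + 2) \<notin> \<int>\<^sub>\<le>\<^sub>0"
      using not_zero_at_pole[OF _ assms, of \<rho>] noninteger_if_fractional[of \<beta> n \<theta>] * that(3) by blast
    have "\<rho> + of_real (\<beta> + 2) \<in> ratio_solutions (\<beta> + 1)"
      using zeros_iff_ratio_solution[OF assms regular] that(3) by blast
    moreover have "\<rho> + of_real (\<beta> + 2) \<in> \<real>" using that(4) by (intro Reals_add) auto
    ultimately have "ratio_order (\<beta> + 1) (\<rho> + of_real (\<beta> + 2)) = 1"
      using nonreal(4) * that(1,2) num by simp
    then show ?thesis
      using that(3) zorder_phi[OF assms regular] by (simp add: simple_zero_def)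
  qed
next
  fix \<sigma> :: real
  show "finite {\<rho> \<in> nonzero_zeros \<beta>. - \<sigma> < Re \<rho> \<and> Re \<rho> < 0}"
  proof (cases "\<beta> \<in> \<int>")
    case True
    then obtain k where "\<beta> = of_int k" by (auto elim: Ints_cases)
    with assms have "\<beta> = real (nat k)" by simp
    then show ?thesis using nonzero_zeros_nat(1)[of "nat k"] by simp
  next
    case False
    from finite_zeros_half_plane[OF assms this, of \<sigma>] show ?thesis
      by (rule rev_finite_subset) (auto simp: nonzero_zeros_def)
  qed
qed

end
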